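(* Let $V_1 \to V_2 \to V_3 \to V_4 \to \cdots$ be a coherent sequence of representations of the symmetric groups over a field $\mathbb{F}$ which is centrally stable with stability starting at $N$. Assume that either $\operatorname{char}(\mathbb{F})=0$ or $\operatorname{char}(\mathbb{F}) \geq 2N+2$. Then one of the following holds. (1) $\dim_{\mathbb{F}} V_n = \infty$ for all $n \geq 2N+1$. (2) There exists a polynomial $\phi(n)$ such that $\phi(n) = \dim_{\mathbb{F}} V_n$ for all $n \geq 2N+1$.
   Context: Representations are over $\mathbb{F}$ and may be infinite-dimensional. $S_{n}\subset S_{n+1}$ is the standard inclusion. A coherent sequence is a sequence $V_1 \xrightarrow{\phi_1} V_2 \xrightarrow{\phi_2} \cdots$ with $V_n$ a representation of the symmetric group $S_n$ and $\phi_n$ linear and $S_n$-equivariant. For an $S_{n-1}$-equivariant map $\phi_{n-1}: V_{n-1} \to V_n$ from a representation of $S_{n-1}$ to one of $S_n$, let $W = \operatorname{Ind}_{S_n}^{S_{n+1}} V_n$, let $\phi'_{n-1}: V_{n-1} \to W$ be the composition of $\phi_{n-1}$ with the natural inclusion $V_n \hookrightarrow W$, and let $U \subset W$ be the span of the $S_{n+1}$-orbit of $\{\vec v - (n,n+1)\cdot \vec v : \vec v \in \phi'_{n-1}(V_{n-1})\}$. The central stabilization of $\phi_{n-1}$ is the $S_{n+1}$-representation $\mathcal{C}(V_{n-1} \xrightarrow{\phi_{n-1}} V_n) = W/U$; it comes with a natural $S_n$-equivariant map from $V_n$. A coherent sequence is centrally stable starting at $N \geq 2$ if for all $n \geq N$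 one has $V_{n+1} = \mathcal{C}(V_{n-1} \xrightarrow{\phi_{n-1}} V_n)$ with $\phi_n$ the natural map (i.e. there is an $S_{n+1}$-equivariant isomorphism carrying $\phi_n$ to the natural map). *)

theory Defs
  imports
    Complex_Main
    "HOL-Combinatorics.Combinatorics"
    "HOL-Computational_Algebra.Computational_Algebra"
    "HOL-Library.Function_Algebras"
    "HOL-Library.Set_Algebras"
begin

text \<open>
  Vector spaces are linear subspaces of an ambient vector space, given by a scalar multiplication
  \<open>s\<close> on a type. The members of a sequence of vector spaces are subspaces of the same ambient space,
  with no relation between them assumed. This is no restriction, as any sequence of vector spaces
  embeds into its direct sum. Linear maps and group actions are functions on the type of which only
  the values on the subspace in question matter. The symmetric group on \<open>n\<close> letters consists of the
  functions \<open>\<sigma>\<close> with \<open>\<sigma> permutes {1..n}\<close>, so the inclusion of one symmetric group in the next is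
  a literal inclusion.
\<close>

definition linear_on ::
    "('a::field \<Rightarrow> 'v::ab_group_add \<Rightarrow> 'v) \<Rightarrow> ('a \<Rightarrow> 'w::ab_group_add \<Rightarrow> 'w) \<Rightarrow>
     'v set \<Rightarrow> 'w set \<Rightarrow> ('v \<Rightarrow> 'w) \<Rightarrow> bool" where
  "linear_on s s' V W f \<longleftrightarrow>
     (\<forall>v\<in>V. f v \<in> W) \<and>
     (\<forall>u\<in>V. \<forall>v\<in>V. f (u + v) = f u + f v) \<and>
     (\<forall>c. \<forall>v\<in>V. f (s c v) = s' c (f v))"

definition sym_rep ::
    "('a::field \<Rightarrow> 'v::ab_group_add \<Rightarrow> 'v) \<Rightarrow> nat \<Rightarrow> 'v set \<Rightarrow> ((nat \<Rightarrow> nat) \<Rightarrow> 'v \<Rightarrow> 'v) \<Rightarrow> bool" where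
  "sym_rep s n V \<rho> \<longleftrightarrow>
     module.subspace s V \<and>
     (\<forall>\<sigma>. \<sigma> permutes {1..n} \<longrightarrow> linear_on s s V V (\<rho> \<sigma>)) \<and>
     (\<forall>v\<in>V. \<rho> id v = v) \<and>
     (\<forall>\<sigma> \<tau>. \<sigma> permutes {1..n} \<longrightarrow> \<tau> permutes {1..n} \<longrightarrow> (\<forall>v\<in>V. \<rho> (\<sigma> \<circ> \<tau>) v = \<rho> \<sigma> (\<rho> \<tau> v)))"

definition sym_equivariant ::
    "nat \<Rightarrow> 'v set \<Rightarrow> ((nat \<Rightarrow> nat) \<Rightarrow> 'v \<Rightarrow> 'v) \<Rightarrow> ((nat \<Rightarrow> nat) \<Rightarrow> 'w \<Rightarrow> 'w) \<Rightarrow> ('v \<Rightarrow> 'w) \<Rightarrow> bool" where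
  "sym_equivariant n V \<rho> \<rho>' f \<longleftrightarrow>
     (\<forall>\<sigma>. \<sigma> permutes {1..n} \<longrightarrow> (\<forall>v\<in>V. f (\<rho> \<sigma> v) = \<rho>' \<sigma> (f v)))"

text \<open>The sequences start at index 1. Values at index 0 are irrelevant.\<close>

definition coherent_sequence ::
    "('a::field \<Rightarrow> 'v::ab_group_add \<Rightarrow> 'v) \<Rightarrow> (nat \<Rightarrow> 'v set) \<Rightarrow>
     (nat \<Rightarrow> (nat \<Rightarrow> nat) \<Rightarrow> 'v \<Rightarrow> 'v) \<Rightarrow> (nat \<Rightarrow> 'v \<Rightarrow> 'v) \<Rightarrow> bool" where
  "coherent_sequence s V \<rho> \<phi> \<longleftrightarrow>
     (\<forall>n\<ge>1. sym_rep s n (V n) (\<rho> n)) \<and>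
     (\<forall>n\<ge>1. linear_on s s (V n) (V (Suc n)) (\<phi> n)) \<and>
     (\<forall>n\<ge>1. sym_equivariant n (V n) (\<rho> n) (\<rho> (Suc n)) (\<phi> n))"

definition fun_scale :: "('a \<Rightarrow> 'v \<Rightarrow> 'v) \<Rightarrow> 'a \<Rightarrow> ('b \<Rightarrow> 'v) \<Rightarrow> ('b \<Rightarrow> 'v)" where
  "fun_scale s c f = (\<lambda>x. s c (f x))"

text \<open>
  The representation of \<open>S\<^sub>n\<^sub>+\<^sub>1\<close> induced from the representation \<open>V\<close> of \<open>S\<^sub>n\<close>, in its standard model of
  functions \<open>f\<close> from \<open>S\<^sub>n\<^sub>+\<^sub>1\<close> to \<open>V\<close> with \<open>f (\<sigma> \<tau>) = \<tau>\<^sup>-\<^sup>1 f (\<sigma>)\<close> for \<open>\<tau>\<close> in \<open>S\<^sub>n\<close>, extended by 0 outside of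
  \<open>S\<^sub>n\<^sub>+\<^sub>1\<close>. The function \<open>f\<close> corresponds to the sum of \<open>\<sigma> \<otimes> f \<sigma>\<close> over representatives \<open>\<sigma>\<close> of the cosets
  \<open>S\<^sub>n\<^sub>+\<^sub>1 / S\<^sub>n\<close> in the tensor product of the group algebra of \<open>S\<^sub>n\<^sub>+\<^sub>1\<close> with \<open>V\<close>. The map \<open>ind_incl\<close> is
  the natural inclusion of \<open>V\<close>.
\<close>

definition ind_space ::
    "nat \<Rightarrow> 'v::ab_group_add set \<Rightarrow> ((nat \<Rightarrow> nat) \<Rightarrow> 'v \<Rightarrow> 'v) \<Rightarrow> ((nat \<Rightarrow> nat) \<Rightarrow> 'v) set" where
  "ind_space n V \<rho> =
     {f. (\<forall>\<sigma>. \<sigma> permutes {1..Suc n} \<longrightarrow> f \<sigma> \<in> V) \<and>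
         (\<forall>\<sigma>. \<not> \<sigma> permutes {1..Suc n} \<longrightarrow> f \<sigma> = 0) \<and>
         (\<forall>\<sigma> \<tau>. \<sigma> permutes {1..Suc n} \<longrightarrow> \<tau> permutes {1..n} \<longrightarrow> f (\<sigma> \<circ> \<tau>) = \<rho> (inv \<tau>) (f \<sigma>))}"

definition ind_act :: "(nat \<Rightarrow> nat) \<Rightarrow> ((nat \<Rightarrow> nat) \<Rightarrow> 'v) \<Rightarrow> ((nat \<Rightarrow> nat) \<Rightarrow> 'v)" where
  "ind_act \<sigma> f = (\<lambda>\<tau>. f (inv \<sigma> \<circ> \<tau>))"

definition ind_incl ::
    "nat \<Rightarrow> ((nat \<Rightarrow> nat) \<Rightarrow> 'v::ab_group_add \<Rightarrow> 'v) \<Rightarrow> 'v \<Rightarrow> ((nat \<Rightarrow> nat) \<Rightarrow> 'v)" where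
  "ind_incl n \<rho> v = (\<lambda>\<sigma>. if \<sigma> permutes {1..n} then \<rho> (inv \<sigma>) v else 0)"

text \<open>
  For a map \<open>f\<close> from a representation \<open>V'\<close> of \<open>S\<^sub>n\<^sub>-\<^sub>1\<close> to a representation \<open>V\<close> of \<open>S\<^sub>n\<close> with action \<open>\<rho>\<close>,
  the central stabilization is the quotient of \<open>ind_space n V \<rho>\<close> by the subspace \<open>stab_rel s n \<rho> V' f\<close>.
  Its elements are the cosets \<open>w +o U\<close>.
\<close>

definition stab_rel ::
    "('a::field \<Rightarrow> 'v::ab_group_add \<Rightarrow> 'v) \<Rightarrow> nat \<Rightarrow> ((nat \<Rightarrow> nat) \<Rightarrow> 'v \<Rightarrow> 'v) \<Rightarrow> 'v set \<Rightarrow> ('v \<Rightarrow> 'v) \<Rightarrow>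
     ((nat \<Rightarrow> nat) \<Rightarrow> 'v) set" where
  "stab_rel s n \<rho> V' f =
     module.span (fun_scale s)
       {ind_act \<sigma> (w - ind_act (transpose n (Suc n)) w) | \<sigma> w.
          \<sigma> permutes {1..Suc n} \<and> w \<in> (\<lambda>v. ind_incl n \<rho> (f v)) ` V'}"

definition central_stab ::
    "('a::field \<Rightarrow> 'v::ab_group_add \<Rightarrow> 'v) \<Rightarrow> nat \<Rightarrow> 'v set \<Rightarrow> ((nat \<Rightarrow> nat) \<Rightarrow> 'v \<Rightarrow> 'v) \<Rightarrow>
     'v set \<Rightarrow> ('v \<Rightarrow> 'v) \<Rightarrow> ((nat \<Rightarrow> nat) \<Rightarrow> 'v) set set" where
  "central_stab s n V \<rho> V' f = (\<lambda>w. w +o stab_rel s n \<rho> V' f) ` ind_space n V \<rho>"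

definition central_stab_map ::
    "('a::field \<Rightarrow> 'v::ab_group_add \<Rightarrow> 'v) \<Rightarrow> nat \<Rightarrow> ((nat \<Rightarrow> nat) \<Rightarrow> 'v \<Rightarrow> 'v) \<Rightarrow>
     'v set \<Rightarrow> ('v \<Rightarrow> 'v) \<Rightarrow> 'v \<Rightarrow> ((nat \<Rightarrow> nat) \<Rightarrow> 'v) set" where
  "central_stab_map s n \<rho> V' f v = ind_incl n \<rho> v +o stab_rel s n \<rho> V' f"

text \<open>
  \<open>T\<close> is an isomorphism of representations of \<open>S\<^sub>n\<^sub>+\<^sub>1\<close> from the central stabilization to \<open>X\<close> with
  action \<open>\<rho>X\<close>. The operations of the quotient space are written out on representatives: the sum of
  \<open>w +o U\<close> and \<open>w' +o U\<close> is \<open>(w + w') +o U\<close>, and likewise for scalar multiples and the action.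
\<close>

definition central_stab_iso ::
    "('a::field \<Rightarrow> 'v::ab_group_add \<Rightarrow> 'v) \<Rightarrow> nat \<Rightarrow> 'v set \<Rightarrow> ((nat \<Rightarrow> nat) \<Rightarrow> 'v \<Rightarrow> 'v) \<Rightarrow>
     'v set \<Rightarrow> ('v \<Rightarrow> 'v) \<Rightarrow> 'v set \<Rightarrow> ((nat \<Rightarrow> nat) \<Rightarrow> 'v \<Rightarrow> 'v) \<Rightarrow>
     (((nat \<Rightarrow> nat) \<Rightarrow> 'v) set \<Rightarrow> 'v) \<Rightarrow> bool" where
  "central_stab_iso s n V \<rho> V' f X \<rho>X T \<longleftrightarrow>
     (let W = ind_space n V \<rho>; U = stab_rel s n \<rho> V' f in
        bij_betw T (central_stab s n V \<rho> V' f) X \<and>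
        (\<forall>w\<in>W. \<forall>w'\<in>W. T ((w + w') +o U) = T (w +o U) + T (w' +o U)) \<and>
        (\<forall>c. \<forall>w\<in>W. T (fun_scale s c w +o U) = s c (T (w +o U))) \<and>
        (\<forall>\<sigma>. \<sigma> permutes {1..Suc n} \<longrightarrow> (\<forall>w\<in>W. T (ind_act \<sigma> w +o U) = \<rho>X \<sigma> (T (w +o U)))))"

definition centrally_stable_from ::
    "('a::field \<Rightarrow> 'v::ab_group_add \<Rightarrow> 'v) \<Rightarrow> (nat \<Rightarrow> 'v set) \<Rightarrow>
     (nat \<Rightarrow> (nat \<Rightarrow> nat) \<Rightarrow> 'v \<Rightarrow> 'v) \<Rightarrow> (nat \<Rightarrow> 'v \<Rightarrow> 'v) \<Rightarrow> nat \<Rightarrow> bool" where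
  "centrally_stable_from s V \<rho> \<phi> N \<longleftrightarrow>
     N \<ge> 2 \<and>
     (\<forall>n\<ge>N. \<exists>T. central_stab_iso s n (V n) (\<rho> n) (V (n - 1)) (\<phi> (n - 1)) (V (Suc n)) (\<rho> (Suc n)) T \<and>
        (\<forall>v\<in>V n. T (central_stab_map s n (\<rho> n) (V (n - 1)) (\<phi> (n - 1)) v) = \<phi> n v))"

definition fin_dim :: "('a::field \<Rightarrow> 'v::ab_group_add \<Rightarrow> 'v) \<Rightarrow> 'v set \<Rightarrow> bool" where
  "fin_dim s V \<longleftrightarrow> (\<exists>B. finite B \<and> module.span s B = V)"

end

theory Submission
  imports Defs
begin

text \<open>
  A centrally stable sequence is a functor on finite sets and injections. Attach to every finite set
  \<open>S\<close> of size \<open>n\<close> a copy \<open>V S\<close> of \<open>V n\<close>, and consider the Koszul complex whose \<open>p\<close>-chains at \<open>S\<close> are the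
  alternating families \<open>x i\<^sub>1 \<dots> i\<^sub>p \<in> V (S - {i\<^sub>1, \<dots>, i\<^sub>p})\<close>. Central stability from \<open>N\<close> on says exactly that
  this complex is exact in degrees 0 and 1 at all \<open>S\<close> with more than \<open>N\<close> elements.

  For a point \<open>a\<close> let the derivative \<open>D V\<close> be the functor \<open>V (S \<union> {a}) / V S\<close> on the sets without \<open>a\<close>.
  The complex of \<open>V\<close> at \<open>S \<union> {a}\<close> is the mapping cone of the map from the complex of \<open>V\<close> at \<open>S\<close> to that
  of \<open>V (- \<union> {a})\<close> at \<open>S\<close>. Hence exactness in degrees 0 and 1 at \<open>S \<union> {a}\<close> passes to \<open>D V\<close> at \<open>S\<close>, and
  exactness of \<open>D V\<close> in degree 2 implies that \<open>V S \<rightarrow> V (S \<union> {a})\<close> is injective and, in turn, that \<open>V\<close>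
  is exact in degree 2. As the derivative lowers \<open>N\<close> by one, induction gives injectivity for all sets
  with at least \<open>2 N\<close> elements, so the first difference of the dimension of \<open>V\<close> is the dimension of
  \<open>D V\<close>, which is polynomial by induction.
\<close>

subsection \<open>Linear algebra on subspaces\<close>

text \<open>The long exact sequence of the mapping cone cannot simply be quoted: it presupposes that
  \<open>V S\<close> embeds into \<open>V (S \<union> {a})\<close>, which is the claim. Without
  injectivity, a 2-cycle can be corrected to a boundary only up to an error in the kernel of adding
  \<open>a\<close>. Symmetry removes this obstacle: renaming \<open>a\<close> to another point shows
  that the kernel is the same for every added point, so the boundary over \<open>S\<close> kills the
  error. This is why the functor is indexed by sets and not by sizes. The constants: exactness in
  degrees 0 and 1 begins at \<open>M = N + 1\<close> points, which gives exactness in degree 2 from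
  \<open>2 * M\<close> points and injectivity from \<open>2 * M - 2 = 2 * N\<close> points. The
  dichotomy begins one size later, at \<open>2 * N + 1\<close>: finite dimension there forces the
  derivative to be finite-dimensional at \<open>2 * N\<close> points, whereas finite dimension of
  \<open>V\<close> at \<open>2 * N\<close> points would say nothing about the derivative.\<close>

context vector_space
begin

context
  fixes V W :: "'b set" and f :: "'b \<Rightarrow> 'b"
  assumes f: "linear_on scale scale V W f" and V: "subspace V"
begin

lemma linear_on_mem: "v \<in> V \<Longrightarrow> f v \<in> W"
  and linear_on_add: "u \<in> V \<Longrightarrow> v \<in> V \<Longrightarrow> f (u + v) = f u + f v"
  and linear_on_scale: "v \<in> V \<Longrightarrow> f (c *s v) = c *s f v"
  using f by (auto simp: linear_on_def)

lemma linear_on_0: "f 0 = 0"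
  using linear_on_scale[of 0 0] subspace_0[OF V] by simp

lemma linear_on_minus: "v \<in> V \<Longrightarrow> f (- v) = - f v"
  using linear_on_scale[of v "-1"] by (simp add: scale_minus_left)

lemma linear_on_diff: "u \<in> V \<Longrightarrow> v \<in> V \<Longrightarrow> f (u - v) = f u - f v"
  using linear_on_add[of u "- v"] linear_on_minus[of v] subspace_neg[OF V, of v] by simp

lemma linear_on_sum: "(\<And>i. i \<in> A \<Longrightarrow> x i \<in> V) \<Longrightarrow> f (\<Sum>i\<in>A. x i) = (\<Sum>i\<in>A. f (x i))"
proof (induction A rule: infinite_finite_induct)
  case (insert i A)
  then have "(\<Sum>i\<in>A. x i) \<in> V" by (intro subspace_sum[OF V]) auto
  with insert show ?case by (simp add: linear_on_add)
qed (simp_all add: linear_on_0)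

lemma subspace_linear_on_image: "subspace (f ` V)"
proof (rule subspaceI)
  show "0 \<in> f ` V" using linear_on_0 subspace_0[OF V] by (metis imageI)
next
  fix x y assume "x \<in> f ` V" "y \<in> f ` V"
  then show "x + y \<in> f ` V" using linear_on_add subspace_add[OF V] by (metis (no_types) imageE imageI)
next
  fix c x assume "x \<in> f ` V"
  then show "c *s x \<in> f ` V" using linear_on_scale subspace_scale[OF V] by (metis (no_types) imageE imageI)
qed

end

lemma ex_projection_onto:
  assumes "subspace B"
  obtains q where "Vector_Spaces.linear scale scale q" "\<And>v. q v \<in> B" "\<And>v. v \<in> B \<Longrightarrow> q v = v"
proof -
  interpret vector_space_pair scale scale ..
  have "\<exists>g. g ` UNIV \<subseteq> B \<and> Vector_Spaces.linear scale scale g \<and> (\<forall>v\<in>B. g (id v) = v)"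
    by (rule linear_exists_left_inverse_on[OF linear_id assms]) auto
  then show ?thesis using that by auto
qed

text \<open>The range of \<open>p\<close> is a complement of \<open>B\<close>, hence a model of the
  quotient of \<open>A\<close> by \<open>B\<close> that stays inside \<open>A\<close>. It is the
  identity minus a projection onto \<open>B\<close>.\<close>

lemma ex_projection_along:
  assumes A: "subspace A" and B: "subspace B" and "B \<subseteq> A"
  obtains p where "linear_on scale scale A A p"
    "\<And>v. v \<in> A \<Longrightarrow> p v = 0 \<longleftrightarrow> v \<in> B" "\<And>v. v \<in> A \<Longrightarrow> v - p v \<in> B"
    "\<And>v. v \<in> A \<Longrightarrow> p (p v) = p v"
proof -
  obtain q where q: "Vector_Spaces.linear scale scale q" "\<And>v. q v \<in> B" "\<And>v. v \<in> B \<Longrightarrow> q v = v"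
    using ex_projection_onto[OF B] by blast
  interpret q: Vector_Spaces.linear scale scale q by fact
  have "q v \<in> A" for v using q(2) assms(3) by auto
  then have "linear_on scale scale A A (\<lambda>v. v - q v)"
    by (auto simp: linear_on_def q.add q.scale subspace_diff[OF A] scale_right_diff_distrib)
  moreover have "v - q v = 0 \<longleftrightarrow> v \<in> B" for v
    using q(2,3) by (metis right_minus_eq)
  ultimately show ?thesis
    using q(2,3) by (intro that[of "\<lambda>v. v - q v"]) (auto simp: q.diff)
qed

text \<open>Lifting an antisymmetric family through \<open>f\<close> must keep it antisymmetric, so
  the section has to commute with negation. An arbitrary choice \<open>g\<close> of preimages
  becomes canonical after a projection along the kernel of \<open>f\<close>, because the projected
  vector depends only on \<open>f v\<close>. No division by 2 is involved.\<close>

lemma ex_odd_section: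
  assumes f: "linear_on scale scale V W f" and V: "subspace V"
  obtains r where "\<And>y. y \<in> f ` V \<Longrightarrow> r y \<in> V" "\<And>y. y \<in> f ` V \<Longrightarrow> f (r y) = y"
    "\<And>y. y \<in> f ` V \<Longrightarrow> r (- y) = - r y"
proof -
  define K where "K = {v \<in> V. f v = 0}"
  have K: "subspace K"
    by (rule subspaceI)
      (auto simp: K_def linear_on_0[OF f V] linear_on_add[OF f V] linear_on_scale[OF f V]
        subspace_0[OF V] subspace_add[OF V] subspace_scale[OF V])
  have "K \<subseteq> V" by (simp add: K_def)
  then obtain p where p: "linear_on scale scale V V p" "\<And>v. v \<in> V \<Longrightarrow> p v = 0 \<longleftrightarrow> v \<in> K"
      "\<And>v. v \<in> V \<Longrightarrow> v - p v \<in> K"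
    using ex_projection_along[OF V K] by metis
  define g where "g = (\<lambda>y. SOME v. v \<in> V \<and> f v = y)"
  have g: "g y \<in> V \<and> f (g y) = y" if "y \<in> f ` V" for y
    unfolding g_def by (rule someI_ex) (use that in auto)
  have "p v = p v'" if "v \<in> V" "v' \<in> V" "f v = f v'" for v v'
  proof -
    have "v - v' \<in> K"
      using that by (simp add: K_def linear_on_diff[OF f V] subspace_diff[OF V])
    then have "p (v - v') = 0" using p(2) that by (simp add: subspace_diff[OF V])
    then show ?thesis using that by (simp add: linear_on_diff[OF p(1) V])
  qed
  note p_eq = this
  show ?thesis
  proof (rule that[of "\<lambda>y. p (g y)"])
    fix y assume y: "y \<in> f ` V"
    show 1: "p (g y) \<in> V" using g[OF y] linear_on_mem[OF p(1) V] by blast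
    have "f (g y - p (g y)) = 0" using p(3)[of "g y"] g[OF y] by (simp add: K_def)
    then show "f (p (g y)) = y" using g[OF y] 1 by (simp add: linear_on_diff[OF f V])
    have y': "- y \<in> f ` V" using y subspace_neg[OF subspace_linear_on_image[OF f V]] by blast
    have "p (g (- y)) = p (- g y)"
      using g[OF y] g[OF y'] by (intro p_eq) (auto simp: linear_on_minus[OF f V] subspace_neg[OF V])
    then show "p (g (- y)) = - p (g y)"
      using g[OF y] by (simp add: linear_on_minus[OF p(1) V])
  qed
qed

lemma fin_dim_iff_finite_basis:
  "fin_dim scale V \<longleftrightarrow> (\<exists>B. finite B \<and> independent B \<and> span B = V)"
proof
  assume "fin_dim scale V"
  then obtain T where T: "finite T" "span T = V" by (auto simp: fin_dim_def)
  obtain B where B: "B \<subseteq> T" "independent B" "T \<subseteq> span B" using maximal_independent_subset by blast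
  then have "span B = V"
    using T(2) span_mono[OF B(1)] span_minimal[OF B(3) subspace_span] by blast
  then show "\<exists>B. finite B \<and> independent B \<and> span B = V"
    using B(2) finite_subset[OF B(1) T(1)] by metis
qed (auto simp: fin_dim_def)

lemma fin_dim_subset:
  assumes "fin_dim scale V" "subspace W" "W \<subseteq> V"
  shows "fin_dim scale W"
proof -
  obtain T where T: "finite T" "span T = V" using assms(1) by (auto simp: fin_dim_def)
  obtain B where B: "B \<subseteq> W" "independent B" "W \<subseteq> span B" using maximal_independent_subset by blast
  have "finite B" using independent_span_bound[OF T(1) B(2)] B(1) assms(3) T(2) by auto
  moreover have "span B = W" using B span_minimal[OF B(1) assms(2)] by auto
  ultimately show ?thesis by (auto simp: fin_dim_def)
qed

text \<open>\<open>f\<close> is linear on \<open>V\<close> only. Precomposed with a projection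
  \<open>q\<close> onto \<open>V\<close> it becomes a globally linear map with the same values on
  \<open>V\<close>, and images of bases can be taken.\<close>

lemma fin_dim_linear_on_image:
  assumes f: "linear_on scale scale V W f" and V: "subspace V" and fd: "fin_dim scale V"
  shows "fin_dim scale (f ` V) \<and> (inj_on f V \<longrightarrow> dim (f ` V) = dim V)"
proof -
  obtain B where B: "finite B" "independent B" "span B = V"
    using fd unfolding fin_dim_iff_finite_basis by blast
  obtain q where q: "Vector_Spaces.linear scale scale q" "\<And>v. q v \<in> V" "\<And>v. v \<in> V \<Longrightarrow> q v = v"
    using ex_projection_onto[OF V] by blast
  interpret q: Vector_Spaces.linear scale scale q by fact
  interpret vector_space_pair scale scale ..
  have lin: "Vector_Spaces.linear scale scale (f \<circ> q)"
    by unfold_locales (auto simp: q.add q.scale linear_on_add[OF f V] linear_on_scale[OF f V] q(2))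
  have im: "(f \<circ> q) ` V = f ` V" using q(3) by (auto simp: image_def)
  then have sp: "span ((f \<circ> q) ` B) = f ` V" using linear_span_image[OF lin, of B] B(3) by simp
  then have "fin_dim scale (f ` V)" using B(1) by (auto simp: fin_dim_def)
  moreover have "dim (f ` V) = dim V" if inj: "inj_on f V"
  proof -
    have inj': "inj_on (f \<circ> q) V" using inj q(3) by (simp add: inj_on_def)
    have "independent ((f \<circ> q) ` B)"
      using linear_independent_injective_image linear_dependent_inj_imageD[OF lin] B inj' by metis
    then have "dim (f ` V) = card ((f \<circ> q) ` B)" using sp dim_span_eq_card_independent by metis
    also have "\<dots> = card B"
      by (rule card_image) (use inj' B(3) span_superset inj_on_subset in blast)
    also have "\<dots> = dim V" using B dim_span_eq_card_independent by metis
    finally show ?thesis .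
  qed
  ultimately show ?thesis by blast
qed

lemma independent_Un_disjoint_span:
  assumes "finite C" "independent B" "independent C" "span B \<inter> span C = {0}"
  shows "independent (B \<union> C)"
  using assms
proof (induction C)
  case (insert x C)
  have C: "independent C" "x \<notin> span C"
    using insert.prems(2) insert.hyps(2) by (auto simp: independent_insert)
  have "span B \<inter> span C \<subseteq> {0}"
    using insert.prems(3) span_mono[of C "insert x C"] by auto
  then have "span B \<inter> span C = {0}" using span_zero by blast
  then have ind: "independent (B \<union> C)" using insert.IH insert.prems(1) C(1) by blast
  have "x \<notin> span (B \<union> C)"
  proof
    assume "x \<in> span (B \<union> C)"
    then obtain u w where uw: "u \<in> span B" "w \<in> span C" "x = u + w"
      by (auto simp: span_Un)
    have "w \<in> span (insert x C)" "x \<in> span (insert x C)"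
      using uw(2) span_mono[of C "insert x C"] by (auto intro: span_base)
    then have "u \<in> span (insert x C)" using uw(3) span_diff[of x "insert x C" w] by simp
    then have "u = 0" using uw(1) insert.prems(3) by auto
    then show False using uw C(2) by simp
  qed
  then show ?case using ind by (simp add: independent_insert)
qed simp

lemma dim_direct_sum:
  assumes A: "subspace A" and B: "subspace B" "B \<subseteq> A" and C: "subspace C" "C \<subseteq> A"
    and int: "B \<inter> C \<subseteq> {0}" and sum: "\<And>v. v \<in> A \<Longrightarrow> \<exists>u\<in>B. \<exists>w\<in>C. v = u + w"
  shows "fin_dim scale A \<longleftrightarrow> fin_dim scale B \<and> fin_dim scale C"
    and "fin_dim scale A \<Longrightarrow> dim A = dim B + dim C"
proof -
  have *: "fin_dim scale A \<and> dim A = dim B + dim C" if fd: "fin_dim scale B" "fin_dim scale C"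
  proof -
    obtain b where b: "finite b" "independent b" "span b = B"
      using fd(1) unfolding fin_dim_iff_finite_basis by blast
    obtain c where c: "finite c" "independent c" "span c = C"
      using fd(2) unfolding fin_dim_iff_finite_basis by blast
    have int': "span b \<inter> span c = {0}"
      using int b(3) c(3) span_zero by blast
    have ind: "independent (b \<union> c)"
      using independent_Un_disjoint_span[OF c(1) b(2) c(2) int'] .
    have sp: "span (b \<union> c) = A"
    proof
      show "span (b \<union> c) \<subseteq> A"
        using b(3) c(3) B(2) C(2) span_superset by (intro span_minimal[OF _ A]) blast
      show "A \<subseteq> span (b \<union> c)"
        using sum unfolding span_Un b(3) c(3) by blast
    qed
    have "0 \<notin> b" using b(2) dependent_zero by blast
    moreover have "b \<inter> c \<subseteq> {0}"
      using int' span_superset[of b] span_superset[of c] by blast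
    ultimately have "b \<inter> c = {}" by blast
    then have "card (b \<union> c) = card b + card c" using b(1) c(1) by (simp add: card_Un_disjoint)
    then show ?thesis
      using b c sp ind dim_span_eq_card_independent unfolding fin_dim_def by (metis finite_UnI)
  qed
  show "fin_dim scale A \<longleftrightarrow> fin_dim scale B \<and> fin_dim scale C"
    using * fin_dim_subset B C by blast
  then show "fin_dim scale A \<Longrightarrow> dim A = dim B + dim C" using * by blast
qed

end

subsection \<open>Koszul complexes of functors on finite sets\<close>

definition chain1 :: "('i set \<Rightarrow> 'v set) \<Rightarrow> 'i set \<Rightarrow> ('i \<Rightarrow> 'v) \<Rightarrow> bool" where
  "chain1 V S x \<longleftrightarrow> (\<forall>i\<in>S. x i \<in> V (S - {i}))"

text \<open>Antisymmetric families on ordered tuples of distinct points stand in for exterior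
  powers, so no order on the points and no signs enter the boundary. Values at tuples with repeated
  points are junk.\<close>

definition chain2 ::
    "('i set \<Rightarrow> 'v::ab_group_add set) \<Rightarrow> 'i set \<Rightarrow> ('i \<Rightarrow> 'i \<Rightarrow> 'v) \<Rightarrow> bool" where
  "chain2 V S z \<longleftrightarrow> (\<forall>i\<in>S. \<forall>j\<in>S - {i}. z i j \<in> V (S - {i} - {j}) \<and> z j i = - z i j)"

definition chain3 ::
    "('i set \<Rightarrow> 'v::ab_group_add set) \<Rightarrow> 'i set \<Rightarrow> ('i \<Rightarrow> 'i \<Rightarrow> 'i \<Rightarrow> 'v) \<Rightarrow> bool" where
  "chain3 V S t \<longleftrightarrow> (\<forall>i\<in>S. \<forall>j\<in>S - {i}. \<forall>k\<in>S - {i} - {j}.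
     t i j k \<in> V (S - {i} - {j} - {k}) \<and> t j i k = - t i j k \<and> t i k j = - t i j k)"

text \<open>One operator serves all degrees: the boundary of a higher chain is \<open>bd\<close> in
  the last index, with the leading points fixed and removed from \<open>S\<close>.\<close>

definition bd ::
    "('i \<Rightarrow> 'i set \<Rightarrow> 'v \<Rightarrow> 'v::ab_group_add) \<Rightarrow> 'i set \<Rightarrow> ('i \<Rightarrow> 'v) \<Rightarrow> 'v" where
  "bd e S x = (\<Sum>i\<in>S. e i S (x i))"

definition exact0 where
  "exact0 V e S \<longleftrightarrow> (\<forall>v\<in>V S. \<exists>x. chain1 V S x \<and> v = bd e S x)"

definition exact1 where
  "exact1 V e S \<longleftrightarrow> (\<forall>x. chain1 V S x \<longrightarrow> bd e S x = 0 \<longrightarrow>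
     (\<exists>z. chain2 V S z \<and> (\<forall>i\<in>S. x i = bd e (S - {i}) (z i))))"

definition exact2 where
  "exact2 V e S \<longleftrightarrow> (\<forall>z. chain2 V S z \<longrightarrow> (\<forall>i\<in>S. bd e (S - {i}) (z i) = 0) \<longrightarrow>
     (\<exists>t. chain3 V S t \<and> (\<forall>i\<in>S. \<forall>j\<in>S - {i}. z i j = bd e (S - {i} - {j}) (t i j))))"

lemma chain2D:
  assumes "chain2 V S z" "i \<in> S" "j \<in> S - {i}"
  shows "z i j \<in> V (S - {i} - {j})" "z j i = - z i j"
  using assms unfolding chain2_def by blast+

lemma chain3D:
  assumes "chain3 V S t" "i \<in> S" "j \<in> S - {i}" "k \<in> S - {i} - {j}"
  shows "t i j k \<in> V (S - {i} - {j} - {k})" "t j i k = - t i j k" "t i k j = - t i j k"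
  using assms unfolding chain3_def by blast+

text \<open>The induction cancels \<open>f i j\<close> against \<open>f j i\<close> pair by pair.
  Comparing the sum with its negative would only show that twice the sum vanishes.\<close>

lemma sum_antisym_eq_0:
  fixes f :: "'i \<Rightarrow> 'i \<Rightarrow> 'v::ab_group_add"
  assumes "finite A" and "\<And>i j. i \<in> A \<Longrightarrow> j \<in> A \<Longrightarrow> i \<noteq> j \<Longrightarrow> f j i = - f i j"
  shows "(\<Sum>i\<in>A. \<Sum>j\<in>A - {i}. f i j) = 0"
  using assms
proof (induction A)
  case (insert a A)
  have "(\<Sum>j\<in>insert a A - {i}. f i j) = f i a + (\<Sum>j\<in>A - {i}. f i j)" if "i \<in> A" for i
  proof -
    have "insert a A - {i} = insert a (A - {i})" using that insert.hyps by auto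
    then show ?thesis using insert.hyps by simp
  qed
  then have "(\<Sum>i\<in>A. \<Sum>j\<in>insert a A - {i}. f i j) = (\<Sum>i\<in>A. f i a) + (\<Sum>i\<in>A. \<Sum>j\<in>A - {i}. f i j)"
    by (simp add: sum.distrib)
  also have "(\<Sum>i\<in>A. \<Sum>j\<in>A - {i}. f i j) = 0"
    by (rule insert.IH) (rule insert.prems; simp)
  also have "(\<Sum>i\<in>A. f i a) + 0 = (\<Sum>i\<in>A. f i a)" by simp
  also have "\<dots> = (\<Sum>i\<in>A. - f a i)"
    using insert.hyps by (intro sum.cong refl insert.prems) auto
  finally show ?case using insert.hyps by (simp add: sum_negf)
qed simp

text \<open>A functor on finite subsets of \<open>U\<close> and injections, reduced to two kinds of
  maps: \<open>e i S\<close> adds the point \<open>i\<close> and has target \<open>V S\<close>, so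
  \<open>i\<close> lies in \<open>S\<close>; \<open>\<theta> i j S\<close> renames \<open>i\<close>
  to \<open>j\<close> and fixes \<open>S\<close>, so neither point lies in \<open>S\<close>. The set
  \<open>U\<close> is a parameter because the derivative lives on \<open>U - {a}\<close>.\<close>

locale subset_module = vector_space scale
  for scale :: "'a::field \<Rightarrow> 'v::ab_group_add \<Rightarrow> 'v" (infixr \<open>*s\<close> 75) +
  fixes U :: "'i set"
    and V :: "'i set \<Rightarrow> 'v set"
    and e :: "'i \<Rightarrow> 'i set \<Rightarrow> 'v \<Rightarrow> 'v"
    and \<theta> :: "'i \<Rightarrow> 'i \<Rightarrow> 'i set \<Rightarrow> 'v \<Rightarrow> 'v"
  assumes subspace_V: "finite S \<Longrightarrow> S \<subseteq> U \<Longrightarrow> subspace (V S)"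
    and linear_e: "finite S \<Longrightarrow> S \<subseteq> U \<Longrightarrow> i \<in> S \<Longrightarrow> linear_on scale scale (V (S - {i})) (V S) (e i S)"
    and e_commute: "finite S \<Longrightarrow> S \<subseteq> U \<Longrightarrow> i \<in> S \<Longrightarrow> j \<in> S \<Longrightarrow> i \<noteq> j \<Longrightarrow> v \<in> V (S - {i} - {j}) \<Longrightarrow>
      e i S (e j (S - {i}) v) = e j S (e i (S - {j}) v)"
    and linear_swap: "finite S \<Longrightarrow> S \<subseteq> U \<Longrightarrow> i \<in> U - S \<Longrightarrow> j \<in> U - S \<Longrightarrow>
      linear_on scale scale (V (insert i S)) (V (insert j S)) (\<theta> i j S)"
    and swap_e_same: "finite S \<Longrightarrow> S \<subseteq> U \<Longrightarrow> i \<in> U - S \<Longrightarrow> j \<in> U - S \<Longrightarrow> v \<in> V S \<Longrightarrow>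
      \<theta> i j S (e i (insert i S) v) = e j (insert j S) v"
    and swap_e_other: "finite S \<Longrightarrow> S \<subseteq> U \<Longrightarrow> i \<in> U - S \<Longrightarrow> j \<in> U - S \<Longrightarrow> k \<in> S \<Longrightarrow>
      v \<in> V (insert i (S - {k})) \<Longrightarrow>
      \<theta> i j S (e k (insert i S) v) = e k (insert j S) (\<theta> i j (S - {k}) v)"
    and swap_swap: "finite S \<Longrightarrow> S \<subseteq> U \<Longrightarrow> i \<in> U - S \<Longrightarrow> j \<in> U - S \<Longrightarrow> v \<in> V (insert i S) \<Longrightarrow>
      \<theta> j i S (\<theta> i j S v) = v"
begin

lemma subspace_V_Diff: "finite S \<Longrightarrow> S \<subseteq> U \<Longrightarrow> subspace (V (S - A))"
  using subspace_V[of "S - A"] by blast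

lemma
  assumes "finite S" "S \<subseteq> U" "i \<in> S"
  shows e_mem: "v \<in> V (S - {i}) \<Longrightarrow> e i S v \<in> V S"
    and e_0: "e i S 0 = 0"
    and e_add: "u \<in> V (S - {i}) \<Longrightarrow> v \<in> V (S - {i}) \<Longrightarrow> e i S (u + v) = e i S u + e i S v"
    and e_diff: "u \<in> V (S - {i}) \<Longrightarrow> v \<in> V (S - {i}) \<Longrightarrow> e i S (u - v) = e i S u - e i S v"
    and e_minus: "v \<in> V (S - {i}) \<Longrightarrow> e i S (- v) = - e i S v"
    and e_sum: "(\<And>k. k \<in> A \<Longrightarrow> x k \<in> V (S - {i})) \<Longrightarrow> e i S (\<Sum>k\<in>A. x k) = (\<Sum>k\<in>A. e i S (x k))"
  using linear_on_mem[OF linear_e[OF assms] subspace_V_Diff[OF assms(1,2)]]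
    linear_on_0[OF linear_e[OF assms] subspace_V_Diff[OF assms(1,2)]]
    linear_on_add[OF linear_e[OF assms] subspace_V_Diff[OF assms(1,2)]]
    linear_on_diff[OF linear_e[OF assms] subspace_V_Diff[OF assms(1,2)]]
    linear_on_minus[OF linear_e[OF assms] subspace_V_Diff[OF assms(1,2)]]
    linear_on_sum[OF linear_e[OF assms] subspace_V_Diff[OF assms(1,2)]]
  by blast+

lemma bd_mem:
  assumes "finite S" "S \<subseteq> U" "chain1 V S x"
  shows "bd e S x \<in> V S"
  unfolding bd_def using assms
  by (intro subspace_sum[OF subspace_V]) (auto simp: chain1_def intro: e_mem)

lemma bd_diff:
  assumes "finite S" "S \<subseteq> U" "chain1 V S x" "chain1 V S y"
  shows "bd e S (\<lambda>i. x i - y i) = bd e S x - bd e S y"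
  unfolding bd_def using assms
  by (auto simp: chain1_def e_diff simp flip: sum_subtractf)

lemma bd_bd_eq_0:
  assumes S: "finite S" "S \<subseteq> U" and z: "chain2 V S z"
  shows "bd e S (\<lambda>i. bd e (S - {i}) (z i)) = 0"
proof -
  have "bd e S (\<lambda>i. bd e (S - {i}) (z i)) =
      (\<Sum>i\<in>S. \<Sum>j\<in>S - {i}. e i S (e j (S - {i}) (z i j)))"
    unfolding bd_def using S z
    by (intro sum.cong refl e_sum) (auto intro!: e_mem chain2D(1)[OF z])
  also have "\<dots> = 0"
  proof (rule sum_antisym_eq_0[OF S(1)])
    fix i j assume ij: "i \<in> S" "j \<in> S" "i \<noteq> j"
    have "z i j \<in> V (S - {i} - {j})" "z j i = - z i j"
      using chain2D[OF z, of i j] ij by auto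
    moreover have "S - {i} - {j} = S - {j} - {i}" by auto
    ultimately show "e j S (e i (S - {j}) (z j i)) = - e i S (e j (S - {i}) (z i j))"
      using S ij e_commute[of S i j "z i j"] by (simp add: e_minus e_mem subset_iff)
  qed
  finally show ?thesis .
qed

lemma chain3_chain2:
  assumes "chain3 V S t" "i \<in> S"
  shows "chain2 V (S - {i}) (t i)"
  using assms unfolding chain3_def chain2_def by blast

lemma bd_cong: "(\<And>i. i \<in> S \<Longrightarrow> x i = y i) \<Longrightarrow> bd e S x = bd e S y"
  by (simp add: bd_def)

lemma bd_insert:
  assumes "finite S" "a \<notin> S"
  shows "bd e (insert a S) x = e a (insert a S) (x a) + (\<Sum>i\<in>S. e i (insert a S) (x i))"
  using assms by (simp add: bd_def)

lemma swap_mem: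
  "finite S \<Longrightarrow> S \<subseteq> U \<Longrightarrow> i \<in> U - S \<Longrightarrow> j \<in> U - S \<Longrightarrow> v \<in> V (insert i S) \<Longrightarrow> \<theta> i j S v \<in> V (insert j S)"
  using linear_swap by (auto simp: linear_on_def)

text \<open>Renaming \<open>a\<close> to \<open>b\<close> carries one inclusion of
  \<open>V S\<close> to the other. Thus an error annihilated by \<open>e a\<close> is annihilated by
  adding any other point, which is the decisive use of the symmetric group action.\<close>

lemma ker_e_indep:
  assumes "finite S" "S \<subseteq> U" "a \<in> U - S" "b \<in> U - S" "v \<in> V S" "e a (insert a S) v = 0"
  shows "e b (insert b S) v = 0"
proof -
  have "subspace (V (insert a S))" using assms subspace_V[of "insert a S"] by simp
  then have "\<theta> a b S 0 = 0" using linear_on_0[OF linear_swap[OF assms(1-4)]] by simp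
  then show ?thesis using swap_e_same[OF assms(1-5)] assms(6) by simp
qed

end

subsection \<open>Derivatives\<close>

locale subset_module_derivative = subset_module +
  fixes a assumes a: "a \<in> U"
begin

definition img :: "'c set \<Rightarrow> 'b set" where
  "img S = e a (insert a S) ` V S"

definition P :: "'c set \<Rightarrow> 'b \<Rightarrow> 'b" where
  "P S = (SOME p. linear_on scale scale (V (insert a S)) (V (insert a S)) p \<and>
     (\<forall>v\<in>V (insert a S). (p v = 0 \<longleftrightarrow> v \<in> img S) \<and> v - p v \<in> img S \<and> p (p v) = p v))"

text \<open>
  The quotient of \<open>V (insert a S)\<close> by the image of \<open>V S\<close> is realised as a complement, the range of a
  projection \<open>P S\<close> along that image. So the derivative stays in the same ambient space, and the inclusion
  of the complement is a linear section of the quotient map.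
\<close>

definition dV :: "'c set \<Rightarrow> 'b set" where
  "dV S = P S ` V (insert a S)"

definition de :: "'c \<Rightarrow> 'c set \<Rightarrow> 'b \<Rightarrow> 'b" where
  "de i S w = P S (e i (insert a S) w)"

definition dswap :: "'c \<Rightarrow> 'c \<Rightarrow> 'c set \<Rightarrow> 'b \<Rightarrow> 'b" where
  "dswap i j S w = P (insert j S) (\<theta> i j (insert a S) w)"

abbreviation "idx S \<equiv> finite S \<and> S \<subseteq> U - {a}"

lemma idx_simps:
  assumes "idx S"
  shows "finite S" "S \<subseteq> U" "a \<notin> S" "finite (insert a S)" "insert a S \<subseteq> U" "insert a S - {a} = S"
  using assms a by auto

lemma insert_a_Diff: "idx S \<Longrightarrow> i \<in> S \<Longrightarrow> insert a S - {i} = insert a (S - {i})"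
  by auto

lemma subspace_V_insert: "idx S \<Longrightarrow> subspace (V (insert a S))"
  and subspace_V': "idx S \<Longrightarrow> subspace (V S)"
  using subspace_V[of "insert a S"] subspace_V[of S] a by auto

lemma linear_e_a: "idx S \<Longrightarrow> linear_on scale scale (V S) (V (insert a S)) (e a (insert a S))"
  using linear_e[of "insert a S" a] idx_simps[of S] by simp

lemma subspace_img: "idx S \<Longrightarrow> subspace (img S)"
  unfolding img_def by (rule subspace_linear_on_image[OF linear_e_a subspace_V'])

lemma img_subset: "idx S \<Longrightarrow> img S \<subseteq> V (insert a S)"
  using linear_e_a[of S] unfolding img_def linear_on_def by blast

lemma P_spec:
  assumes "idx S"
  shows "linear_on scale scale (V (insert a S)) (V (insert a S)) (P S) \<and>
     (\<forall>v\<in>V (insert a S). (P S v = 0 \<longleftrightarrow> v \<in> img S) \<and> v - P S v \<in> img S \<and> P S (P S v) = P S v)"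
proof -
  obtain p where "linear_on scale scale (V (insert a S)) (V (insert a S)) p"
    "\<And>v. v \<in> V (insert a S) \<Longrightarrow> p v = 0 \<longleftrightarrow> v \<in> img S"
    "\<And>v. v \<in> V (insert a S) \<Longrightarrow> v - p v \<in> img S"
    "\<And>v. v \<in> V (insert a S) \<Longrightarrow> p (p v) = p v"
    using ex_projection_along[OF subspace_V_insert[OF assms] subspace_img[OF assms] img_subset[OF assms]]
    by metis
  then have "\<exists>p. linear_on scale scale (V (insert a S)) (V (insert a S)) p \<and>
     (\<forall>v\<in>V (insert a S). (p v = 0 \<longleftrightarrow> v \<in> img S) \<and> v - p v \<in> img S \<and> p (p v) = p v)"
    by blast
  from someI_ex[OF this] show ?thesis unfolding P_def .
qed

context
  fixes S assumes S: "idx S"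
begin

lemma linear_P: "linear_on scale scale (V (insert a S)) (V (insert a S)) (P S)"
  and P_eq_0_iff: "v \<in> V (insert a S) \<Longrightarrow> P S v = 0 \<longleftrightarrow> v \<in> img S"
  and diff_P_mem: "v \<in> V (insert a S) \<Longrightarrow> v - P S v \<in> img S"
  and P_P: "v \<in> V (insert a S) \<Longrightarrow> P S (P S v) = P S v"
  using P_spec[OF S] by blast+

lemmas P_mem = linear_on_mem[OF linear_P subspace_V_insert[OF S]]
lemmas P_0 = linear_on_0[OF linear_P subspace_V_insert[OF S]]
lemmas P_add = linear_on_add[OF linear_P subspace_V_insert[OF S]]
lemmas P_diff = linear_on_diff[OF linear_P subspace_V_insert[OF S]]
lemmas P_minus = linear_on_minus[OF linear_P subspace_V_insert[OF S]]
lemmas P_sum = linear_on_sum[OF linear_P subspace_V_insert[OF S]]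

lemma dV_subset: "dV S \<subseteq> V (insert a S)"
  using P_mem by (auto simp: dV_def)

lemma P_dV: "w \<in> dV S \<Longrightarrow> P S w = w"
  using P_P by (auto simp: dV_def)

lemma P_in_dV: "v \<in> V (insert a S) \<Longrightarrow> P S v \<in> dV S"
  by (auto simp: dV_def)

lemma subspace_dV: "subspace (dV S)"
  unfolding dV_def by (rule subspace_linear_on_image[OF linear_P subspace_V_insert[OF S]])

lemma P_img: "v \<in> V S \<Longrightarrow> P S (e a (insert a S) v) = 0"
  using P_eq_0_iff[of "e a (insert a S) v"] img_subset[OF S] by (auto simp: img_def)

end

lemma idx_Diff: "idx S \<Longrightarrow> idx (S - B)"
  by auto

lemma idx_insert: "idx S \<Longrightarrow> i \<in> U - {a} - S \<Longrightarrow> idx (insert i S)"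
  by auto

lemma e_mem':
  assumes "idx S" "i \<in> S" "v \<in> V (insert a (S - {i}))"
  shows "e i (insert a S) v \<in> V (insert a S)"
  using e_mem[of "insert a S" i v] assms idx_simps[OF assms(1)] insert_a_Diff[OF assms(1,2)] by simp

lemma linear_e':
  assumes "idx S" "i \<in> S"
  shows "linear_on scale scale (V (insert a (S - {i}))) (V (insert a S)) (e i (insert a S))"
  using linear_e[of "insert a S" i] assms idx_simps[OF assms(1)] insert_a_Diff[OF assms] by simp

lemma e_commute_a:
  assumes "idx S" "i \<in> S" "v \<in> V (S - {i})"
  shows "e i (insert a S) (e a (insert a (S - {i})) v) = e a (insert a S) (e i S v)"
proof -
  have "insert a S - {i} - {a} = S - {i}" using idx_simps(3)[OF assms(1)] by auto
  then show ?thesis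
    using e_commute[of "insert a S" i a v] assms idx_simps[OF assms(1)] insert_a_Diff[OF assms(1,2)]
    by auto
qed

text \<open>Well-definedness of the map induced on the quotient: adding \<open>i\<close> commutes
  with adding \<open>a\<close>, so a change of representative by an element of \<open>img\<close> is
  invisible after projection.\<close>

lemma P_e_P:
  assumes S: "idx S" and i: "i \<in> S" and v: "v \<in> V (insert a (S - {i}))"
  shows "P S (e i (insert a S) (P (S - {i}) v)) = P S (e i (insert a S) v)"
proof -
  note Si = idx_Diff[OF S, of "{i}"]
  note Pv = P_mem[OF Si v]
  obtain y where y: "y \<in> V (S - {i})" "v - P (S - {i}) v = e a (insert a (S - {i})) y"
    using diff_P_mem[OF Si v] by (auto simp: img_def)
  have iy: "e i S y \<in> V S" using e_mem[of S i y] i y idx_simps[OF S] by simp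
  have "e i (insert a S) v - e i (insert a S) (P (S - {i}) v) = e i (insert a S) (v - P (S - {i}) v)"
    using linear_on_diff[OF linear_e'[OF S i] subspace_V_insert[OF Si] v Pv] by simp
  also have "\<dots> = e a (insert a S) (e i S y)"
    using e_commute_a[OF S i y(1)] y(2) by simp
  finally have "P S (e i (insert a S) v - e i (insert a S) (P (S - {i}) v)) = 0"
    using P_img[OF S iy] by simp
  then show ?thesis using P_diff[OF S e_mem'[OF S i v] e_mem'[OF S i Pv]] by simp
qed

lemma linear_swap':
  assumes "idx S" "i \<in> U - {a} - S" "j \<in> U - {a} - S"
  shows "linear_on scale scale (V (insert a (insert i S))) (V (insert a (insert j S))) (\<theta> i j (insert a S))"
  using linear_swap[of "insert a S" i j] assms idx_simps[OF assms(1)] by (simp add: insert_commute)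

lemma swap_mem':
  assumes "idx S" "i \<in> U - {a} - S" "j \<in> U - {a} - S" "v \<in> V (insert a (insert i S))"
  shows "\<theta> i j (insert a S) v \<in> V (insert a (insert j S))"
  using linear_swap'[OF assms(1-3)] assms(4) by (auto simp: linear_on_def)

text \<open>The analogue of \<open>P_e_P\<close> for renamings: \<open>swap_e_other\<close> with
  \<open>a\<close> as the added point shows that they preserve \<open>img\<close>.\<close>

lemma P_swap_P:
  assumes S: "idx S" and i: "i \<in> U - {a} - S" and j: "j \<in> U - {a} - S"
    and v: "v \<in> V (insert a (insert i S))"
  shows "P (insert j S) (\<theta> i j (insert a S) (P (insert i S) v)) = P (insert j S) (\<theta> i j (insert a S) v)"
proof -
  note Si = idx_insert[OF S i] and Sj = idx_insert[OF S j]
  note Pv = P_mem[OF Si v]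
  obtain y where y: "y \<in> V (insert i S)" "v - P (insert i S) v = e a (insert a (insert i S)) y"
    using diff_P_mem[OF Si v] by (auto simp: img_def)
  have ty: "\<theta> i j S y \<in> V (insert j S)"
    using swap_mem[of S i j y] i j y idx_simps[OF S] by simp
  have "\<theta> i j (insert a S) v - \<theta> i j (insert a S) (P (insert i S) v) =
      \<theta> i j (insert a S) (v - P (insert i S) v)"
    using linear_on_diff[OF linear_swap'[OF S i j] subspace_V_insert[OF Si] v Pv] by simp
  also have "\<dots> = e a (insert a (insert j S)) (\<theta> i j S y)"
    using swap_e_other[of "insert a S" i j a y] i j y idx_simps[OF S]
    by (simp add: insert_commute)
  finally have "P (insert j S) (\<theta> i j (insert a S) v - \<theta> i j (insert a S) (P (insert i S) v)) = 0"
    using P_img[OF Sj ty] by simp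
  then show ?thesis using P_diff[OF Sj swap_mem'[OF S i j v] swap_mem'[OF S i j Pv]] by simp
qed

text \<open>Inner projections are removed by \<open>P_e_P\<close> and \<open>P_swap_P\<close>. What
  remains is the corresponding axiom for \<open>V\<close> at sets enlarged by \<open>a\<close>,
  followed by one projection.\<close>

lemma derivative: "subset_module scale (U - {a}) dV de dswap"
proof unfold_locales
  fix S :: "'c set" assume S: "finite S" "S \<subseteq> U - {a}"
  then show "subspace (dV S)" using subspace_dV by blast
next
  fix S :: "'c set" and i assume S: "finite S" "S \<subseteq> U - {a}" and i: "i \<in> S"
  then have S': "idx S" by simp
  note Si = idx_Diff[OF S', of "{i}"]
  have "linear_on scale scale (V (insert a (S - {i}))) (dV S) (\<lambda>w. P S (e i (insert a S) w))"
    unfolding linear_on_def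
    using P_in_dV[OF S'] e_mem'[OF S' i] P_add[OF S'] linear_on_scale[OF linear_P[OF S'] subspace_V_insert[OF S']]
      linear_on_add[OF linear_e'[OF S' i] subspace_V_insert[OF Si]]
      linear_on_scale[OF linear_e'[OF S' i] subspace_V_insert[OF Si]]
    by simp
  then show "linear_on scale scale (dV (S - {i})) (dV S) (de i S)"
    using dV_subset[OF Si] by (auto simp: linear_on_def de_def subset_iff)
next
  fix S :: "'c set" and i j v
  assume S: "finite S" "S \<subseteq> U - {a}" and ij: "i \<in> S" "j \<in> S" "i \<noteq> j" and v: "v \<in> dV (S - {i} - {j})"
  then have S': "idx S" by simp
  have v': "v \<in> V (insert a (S - {i} - {j}))" using dV_subset[OF idx_Diff[OF idx_Diff[OF S']]] v by blast
  have *: "de i S (de j (S - {i}) v) = P S (e i (insert a S) (e j (insert a (S - {i})) v))"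
    if "i \<in> S" "j \<in> S" "i \<noteq> j" "v \<in> V (insert a (S - {i} - {j}))" for i j
    unfolding de_def using that S'
    by (intro P_e_P[OF S'] e_mem'[OF idx_Diff[OF S']]) auto
  have [simp]: "S - {j} - {i} = S - {i} - {j}" by blast
  have D: "insert a S - {i} = insert a (S - {i})" "insert a S - {j} = insert a (S - {j})"
     "insert a S - {i} - {j} = insert a (S - {i} - {j})"
    using ij S by auto
  have "e i (insert a S) (e j (insert a S - {i}) v) = e j (insert a S) (e i (insert a S - {j}) v)"
    using ij v' idx_simps[OF S'] D(3) by (intro e_commute) auto
  then show "de i S (de j (S - {i}) v) = de j S (de i (S - {j}) v)"
    using *[of i j] *[of j i] ij v' D by simp
next
  fix S :: "'c set" and i j
  assume S: "finite S" "S \<subseteq> U - {a}" and ij: "i \<in> U - {a} - S" "j \<in> U - {a} - S"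
  then have S': "idx S" by simp
  note Si = idx_insert[OF S' ij(1)] and Sj = idx_insert[OF S' ij(2)]
  have "linear_on scale scale (V (insert a (insert i S))) (dV (insert j S)) (dswap i j S)"
    unfolding linear_on_def dswap_def
    using P_in_dV[OF Sj] swap_mem'[OF S' ij] P_add[OF Sj]
      linear_on_scale[OF linear_P[OF Sj] subspace_V_insert[OF Sj]]
      linear_on_add[OF linear_swap'[OF S' ij] subspace_V_insert[OF Si]]
      linear_on_scale[OF linear_swap'[OF S' ij] subspace_V_insert[OF Si]]
    by simp
  then show "linear_on scale scale (dV (insert i S)) (dV (insert j S)) (dswap i j S)"
    using dV_subset[OF Si] by (auto simp: linear_on_def subset_iff)
next
  fix S :: "'c set" and i j v
  assume S: "finite S" "S \<subseteq> U - {a}" and ij: "i \<in> U - {a} - S" "j \<in> U - {a} - S" and v: "v \<in> dV S"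
  then have S': "idx S" by simp
  note Si = idx_insert[OF S' ij(1)]
  have v': "v \<in> V (insert a S)" using dV_subset[OF S'] v by blast
  have iv: "e i (insert a (insert i S)) v \<in> V (insert a (insert i S))"
    using e_mem'[OF Si, of i v] v' ij by simp
  have "dswap i j S (de i (insert i S) v) = P (insert j S) (\<theta> i j (insert a S) (e i (insert i (insert a S)) v))"
    unfolding dswap_def de_def using P_swap_P[OF S' ij iv] by (simp add: insert_commute)
  also have "\<dots> = de j (insert j S) v"
    using swap_e_same[of "insert a S" i j v] ij v' idx_simps[OF S'] by (simp add: de_def insert_commute)
  finally show "dswap i j S (de i (insert i S) v) = de j (insert j S) v" .
next
  fix S :: "'c set" and i j k v
  assume S: "finite S" "S \<subseteq> U - {a}" and ij: "i \<in> U - {a} - S" "j \<in> U - {a} - S" and k: "k \<in> S"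
    and v: "v \<in> dV (insert i (S - {k}))"
  then have S': "idx S" by simp
  note Si = idx_insert[OF S' ij(1)] and Sj = idx_insert[OF S' ij(2)] and Sk = idx_Diff[OF S', of "{k}"]
  have ij': "i \<in> U - {a} - (S - {k})" "j \<in> U - {a} - (S - {k})" using ij by auto
  have v': "v \<in> V (insert a (insert i (S - {k})))" using dV_subset[OF idx_insert[OF Sk ij'(1)]] v by blast
  have D: "insert i S - {k} = insert i (S - {k})" "insert j S - {k} = insert j (S - {k})"
      "insert a S - {k} = insert a (S - {k})"
    using ij k S by auto
  have kv: "e k (insert a (insert i S)) v \<in> V (insert a (insert i S))"
    using e_mem'[OF Si, of k v] v' k D by simp
  have "dswap i j S (de k (insert i S) v) = P (insert j S) (\<theta> i j (insert a S) (e k (insert i (insert a S)) v))"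
    unfolding dswap_def de_def using P_swap_P[OF S' ij kv] by (simp add: insert_commute)
  also have "\<dots> = P (insert j S) (e k (insert j (insert a S)) (\<theta> i j (insert a (S - {k})) v))"
    using swap_e_other[of "insert a S" i j k v] ij k v' idx_simps[OF S'] D by (simp add: insert_commute)
  also have "\<dots> = de k (insert j S) (dswap i j (S - {k}) v)"
    unfolding dswap_def de_def using P_e_P[OF Sj, of k "\<theta> i j (insert a (S - {k})) v"] k D
      swap_mem'[OF Sk ij' v'] by (simp add: insert_commute)
  finally show "dswap i j S (de k (insert i S) v) = de k (insert j S) (dswap i j (S - {k}) v)" .
next
  fix S :: "'c set" and i j v
  assume S: "finite S" "S \<subseteq> U - {a}" and ij: "i \<in> U - {a} - S" "j \<in> U - {a} - S"
    and v: "v \<in> dV (insert i S)"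
  then have S': "idx S" by simp
  note Si = idx_insert[OF S' ij(1)]
  have v': "v \<in> V (insert a (insert i S))" using dV_subset[OF Si] v by blast
  have "dswap j i S (dswap i j S v) = P (insert i S) (\<theta> j i (insert a S) (\<theta> i j (insert a S) v))"
    unfolding dswap_def using P_swap_P[OF S' ij(2,1) swap_mem'[OF S' ij v']] .
  also have "\<dots> = P (insert i S) v"
    using swap_swap[of "insert a S" i j v] ij v' idx_simps[OF S'] by (simp add: insert_commute)
  also have "\<dots> = v" using P_dV[OF Si v] .
  finally show "dswap j i S (dswap i j S v) = v" .
qed

end

subsection \<open>Exactness of the derivative\<close>

context subset_module
begin

lemma bd_minus:
  assumes "finite S" "S \<subseteq> U" "chain1 V S x"
  shows "bd e S (\<lambda>i. - x i) = - bd e S x"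
  unfolding bd_def using assms
  by (auto simp: chain1_def e_minus simp flip: sum_negf)

lemma chain2_chain1: "chain2 V S z \<Longrightarrow> i \<in> S \<Longrightarrow> chain1 V (S - {i}) (z i)"
  unfolding chain2_def chain1_def by blast

lemma chain2_bd:
  assumes S: "finite S" "S \<subseteq> U" and t: "chain3 V S t"
  shows "chain2 V S (\<lambda>i j. bd e (S - {i} - {j}) (t i j))"
  unfolding chain2_def
proof (intro ballI conjI)
  fix i j assume ij: "i \<in> S" "j \<in> S - {i}"
  have c: "chain1 V (S - {i} - {j}) (t i j)"
    using chain2_chain1[OF chain3_chain2[OF t ij(1)] ij(2)] .
  show "bd e (S - {i} - {j}) (t i j) \<in> V (S - {i} - {j})"
    using S by (intro bd_mem c) auto
  have [simp]: "S - {j} - {i} = S - {i} - {j}" by blast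
  have "bd e (S - {i} - {j}) (t j i) = bd e (S - {i} - {j}) (\<lambda>k. - t i j k)"
    using chain3D(2)[OF t ij] by (intro bd_cong) blast
  also have "\<dots> = - bd e (S - {i} - {j}) (t i j)"
    using S by (intro bd_minus c) auto
  finally show "bd e (S - {j} - {i}) (t j i) = - bd e (S - {i} - {j}) (t i j)" by simp
qed

lemma chain2_diff:
  assumes S: "finite S" "S \<subseteq> U" and z: "chain2 V S z" and y: "chain2 V S y"
  shows "chain2 V S (\<lambda>i j. z i j - y i j)"
  unfolding chain2_def
proof (intro ballI conjI)
  fix i j assume ij: "i \<in> S" "j \<in> S - {i}"
  have "subspace (V (S - {i} - {j}))" using S by (intro subspace_V) auto
  then show "z i j - y i j \<in> V (S - {i} - {j})"
    using subspace_diff chain2D(1)[OF z ij] chain2D(1)[OF y ij] by blast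
  show "z j i - y j i = - (z i j - y i j)"
    using chain2D(2)[OF z ij] chain2D(2)[OF y ij] by simp
qed

end

context subset_module_derivative
begin

lemma chain1_insertD:
  assumes "idx S" "chain1 V (insert a S) x"
  shows "x a \<in> V S" "i \<in> S \<Longrightarrow> x i \<in> V (insert a (S - {i}))"
  using assms idx_simps[OF assms(1)] insert_a_Diff[OF assms(1), of i] by (auto simp: chain1_def)

lemma sum_e_mem:
  assumes "idx S" "\<And>i. i \<in> S \<Longrightarrow> x i \<in> V (insert a (S - {i}))"
  shows "(\<Sum>i\<in>S. e i (insert a S) (x i)) \<in> V (insert a S)"
  using assms e_mem'[OF assms(1)] by (intro subspace_sum[OF subspace_V_insert[OF assms(1)]]) auto

lemma P_sum_e:
  assumes S: "idx S" and x: "\<And>i. i \<in> S \<Longrightarrow> x i \<in> V (insert a (S - {i}))"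
  shows "P S (\<Sum>i\<in>S. e i (insert a S) (x i)) = bd de S (\<lambda>i. P (S - {i}) (x i))"
proof -
  have "P S (\<Sum>i\<in>S. e i (insert a S) (x i)) = (\<Sum>i\<in>S. P S (e i (insert a S) (x i)))"
    using e_mem'[OF S] x by (intro P_sum[OF S]) auto
  also have "\<dots> = bd de S (\<lambda>i. P (S - {i}) (x i))"
    unfolding bd_def de_def using P_e_P[OF S] x by (intro sum.cong) auto
  finally show ?thesis .
qed

text \<open>Projection is a chain map from the complex of \<open>V\<close> at
  \<open>insert a S\<close> to that of the derivative at \<open>S\<close>: the summand with index
  \<open>a\<close> lies in \<open>img\<close> and dies.\<close>

lemma P_bd:
  assumes S: "idx S" and x: "chain1 V (insert a S) x"
  shows "P S (bd e (insert a S) x) = bd de S (\<lambda>i. P (S - {i}) (x i))"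
proof -
  note x' = chain1_insertD[OF S x]
  have "P S (bd e (insert a S) x) =
      P S (e a (insert a S) (x a)) + P S (\<Sum>i\<in>S. e i (insert a S) (x i))"
    using idx_simps[OF S] x' img_subset[OF S]
    by (subst P_add[OF S, symmetric]) (auto simp: bd_insert img_def intro!: sum_e_mem[OF S])
  then show ?thesis using P_img[OF S x'(1)] P_sum_e[OF S x'(2)] by simp
qed

lemma exact0_derivative:
  assumes S: "idx S" and ex: "exact0 V e (insert a S)"
  shows "exact0 dV de S"
  unfolding exact0_def
proof
  fix w assume w: "w \<in> dV S"
  then obtain x where x: "chain1 V (insert a S) x" "w = bd e (insert a S) x"
    using ex dV_subset[OF S] unfolding exact0_def by blast
  have "w = bd de S (\<lambda>i. P (S - {i}) (x i))"
    using P_dV[OF S w] P_bd[OF S x(1)] x(2) by simp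
  moreover have "chain1 dV S (\<lambda>i. P (S - {i}) (x i))"
    using P_in_dV[OF idx_Diff[OF S]] chain1_insertD[OF S x(1)] by (simp add: chain1_def)
  ultimately show "\<exists>x. chain1 dV S x \<and> w = bd de S x" by blast
qed

lemma chain2_P:
  assumes S: "idx S" and z: "chain2 V (insert a S) z"
  shows "chain2 dV S (\<lambda>i j. P (S - {i} - {j}) (z i j))"
  unfolding chain2_def
proof (intro ballI conjI)
  fix i j assume ij: "i \<in> S" "j \<in> S - {i}"
  have "insert a S - {i} - {j} = insert a (S - {i} - {j})" using ij S by auto
  then have z': "z i j \<in> V (insert a (S - {i} - {j}))" "z j i = - z i j"
    using chain2D[OF z, of i j] ij S by auto
  have S': "idx (S - {i} - {j})" using S by auto
  show "P (S - {i} - {j}) (z i j) \<in> dV (S - {i} - {j})" using P_in_dV[OF S' z'(1)] .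
  have [simp]: "S - {j} - {i} = S - {i} - {j}" by blast
  show "P (S - {j} - {i}) (z j i) = - P (S - {i} - {j}) (z i j)"
    using P_minus[OF S' z'(1)] z'(2) by simp
qed

text \<open>A cycle of the derivative, read in \<open>V\<close>, has its boundary in
  \<open>img\<close>, say equal to \<open>e a (insert a S) u\<close>. The extra entry
  \<open>- u\<close> at \<open>a\<close> turns it into a cycle of \<open>V\<close> at
  \<open>insert a S\<close>, and the bounding 2-chain is projected back.\<close>

lemma exact1_derivative:
  assumes S: "idx S" and ex: "exact1 V e (insert a S)"
  shows "exact1 dV de S"
  unfolding exact1_def
proof (intro allI impI)
  fix x assume x: "chain1 dV S x" "bd de S x = 0"
  have x': "x i \<in> V (insert a (S - {i}))" "P (S - {i}) (x i) = x i" if "i \<in> S" for i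
    using x(1) that dV_subset[OF idx_Diff[OF S]] P_dV[OF idx_Diff[OF S]] by (auto simp: chain1_def)
  define y where "y = (\<Sum>i\<in>S. e i (insert a S) (x i))"
  have y: "y \<in> V (insert a S)" unfolding y_def by (rule sum_e_mem[OF S x'(1)])
  have "P S y = bd de S (\<lambda>i. P (S - {i}) (x i))"
    unfolding y_def by (rule P_sum_e[OF S x'(1)])
  also have "\<dots> = bd de S x" using x'(2) by (simp add: bd_def)
  finally have "y \<in> img S" using P_eq_0_iff[OF S y] x(2) by simp
  then obtain u where u: "u \<in> V S" "y = e a (insert a S) u" by (auto simp: img_def)
  define x1 where "x1 = x(a := - u)"
  have "chain1 V (insert a S) x1"
    unfolding chain1_def x1_def using u(1) x'(1) S idx_simps[OF S] insert_a_Diff[OF S] subspace_neg[OF subspace_V'[OF S]]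
    by auto
  moreover have "bd e (insert a S) x1 = 0"
  proof -
    have "bd e (insert a S) x1 = e a (insert a S) (- u) + (\<Sum>i\<in>S. e i (insert a S) (x1 i))"
      using idx_simps[OF S] by (simp add: bd_insert x1_def)
    also have "(\<Sum>i\<in>S. e i (insert a S) (x1 i)) = y"
      unfolding y_def x1_def using S by (intro sum.cong) auto
    finally show ?thesis
      using u linear_on_minus[OF linear_e_a[OF S] subspace_V'[OF S] u(1)] by simp
  qed
  ultimately obtain z where z: "chain2 V (insert a S) z"
      "\<And>i. i \<in> insert a S \<Longrightarrow> x1 i = bd e (insert a S - {i}) (z i)"
    using ex unfolding exact1_def by blast
  have "x i = bd de (S - {i}) (\<lambda>j. P (S - {i} - {j}) (z i j))" if i: "i \<in> S" for i
  proof -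
    have "chain1 V (insert a (S - {i})) (z i)"
      using chain2_chain1[OF z(1), of i] i insert_a_Diff[OF S i] by simp
    then have "P (S - {i}) (bd e (insert a (S - {i})) (z i)) = bd de (S - {i}) (\<lambda>j. P (S - {i} - {j}) (z i j))"
      by (rule P_bd[OF idx_Diff[OF S]])
    moreover have "x i = bd e (insert a (S - {i})) (z i)"
      using z(2)[of i] i insert_a_Diff[OF S i] S by (auto simp: x1_def)
    ultimately show ?thesis using x'(2)[OF i] by simp
  qed
  then show "\<exists>z. chain2 dV S z \<and> (\<forall>i\<in>S. x i = bd de (S - {i}) (z i))"
    using chain2_P[OF S z(1)] by blast
qed

text \<open>
  The projection of \<open>z\<close> to the derivative bounds a 3-chain \<open>t\<close>. The difference of \<open>z\<close> and the boundary of
  \<open>t\<close> lies in the image of the map adding \<open>a\<close>. An odd section of this map turns it into the components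
  of \<open>T\<close> that involve \<open>a\<close>.
\<close>

lemma correct_chain2:
  assumes S: "idx S" and ex: "exact2 dV de S" and z: "chain2 V (insert a S) z"
    and z0: "\<And>i. i \<in> S \<Longrightarrow> bd e (insert a S - {i}) (z i) = 0"
  obtains T where "chain3 V (insert a S) T"
    "\<And>i j. i \<in> S \<Longrightarrow> j \<in> S - {i} \<Longrightarrow> z i j = bd e (insert a S - {i} - {j}) (T i j)"
    "\<And>i. i \<in> S \<Longrightarrow> e a (insert a (S - {i})) (z i a - bd e (S - {i}) (T i a)) = 0"
proof -
  have aS: "a \<notin> S" using S by auto
  have D2: "insert a S - {i} - {j} = insert a (S - {i} - {j})" if "i \<in> S" "j \<in> S - {i}" for i j
    using that aS by auto
  define zz where "zz = (\<lambda>i j. P (S - {i} - {j}) (z i j))"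
  have zz: "chain2 dV S zz" unfolding zz_def by (rule chain2_P[OF S z])
  have "bd de (S - {i}) (zz i) = 0" if i: "i \<in> S" for i
  proof -
    have "chain1 V (insert a (S - {i})) (z i)"
      using chain2_chain1[OF z, of i] i insert_a_Diff[OF S i] by simp
    then have "bd de (S - {i}) (zz i) = P (S - {i}) (bd e (insert a (S - {i})) (z i))"
      unfolding zz_def by (rule P_bd[OF idx_Diff[OF S], symmetric])
    then show ?thesis
      using z0[OF i] insert_a_Diff[OF S i] P_0[OF idx_Diff[OF S]] by simp
  qed
  then obtain t where t: "chain3 dV S t"
      "\<And>i j. i \<in> S \<Longrightarrow> j \<in> S - {i} \<Longrightarrow> zz i j = bd de (S - {i} - {j}) (t i j)"
    using ex zz unfolding exact2_def by blast
  have tV: "t i j k \<in> V (insert a (S - {i} - {j} - {k}))"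
       "P (S - {i} - {j} - {k}) (t i j k) = t i j k"
    if "i \<in> S" "j \<in> S - {i}" "k \<in> S - {i} - {j}" for i j k
    using chain3D(1)[OF t(1) that] dV_subset[of "S - {i} - {j} - {k}"] P_dV[of "S - {i} - {j} - {k}"] S
    by auto
  define Y where "Y = (\<lambda>i j. z i j - (\<Sum>k\<in>S - {i} - {j}. e k (insert a (S - {i} - {j})) (t i j k)))"
  have Y: "Y i j \<in> img (S - {i} - {j})" "Y j i = - Y i j" if ij: "i \<in> S" "j \<in> S - {i}" for i j
  proof -
    have S': "idx (S - {i} - {j})" using S by auto
    have zij: "z i j \<in> V (insert a (S - {i} - {j}))" "z j i = - z i j"
      using chain2D[OF z, of i j] ij aS D2[OF ij] by auto
    let ?s = "\<Sum>k\<in>S - {i} - {j}. e k (insert a (S - {i} - {j})) (t i j k)"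
    have s: "?s \<in> V (insert a (S - {i} - {j}))"
      by (rule sum_e_mem[OF S' tV(1)[OF ij]])
    have "P (S - {i} - {j}) ?s = bd de (S - {i} - {j}) (\<lambda>k. P (S - {i} - {j} - {k}) (t i j k))"
      by (rule P_sum_e[OF S' tV(1)[OF ij]])
    also have "\<dots> = bd de (S - {i} - {j}) (t i j)"
      using tV(2)[OF ij] by (simp add: bd_def)
    finally have "P (S - {i} - {j}) ?s = bd de (S - {i} - {j}) (t i j)" .
    then have "P (S - {i} - {j}) (Y i j) = 0"
      unfolding Y_def P_diff[OF S' zij(1) s] using t(2)[OF ij] by (simp add: zz_def)
    moreover have "Y i j \<in> V (insert a (S - {i} - {j}))"
      unfolding Y_def by (rule subspace_diff[OF subspace_V_insert[OF S'] zij(1) s])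
    ultimately show "Y i j \<in> img (S - {i} - {j})" using P_eq_0_iff[OF S'] by blast
    have [simp]: "S - {j} - {i} = S - {i} - {j}" by blast
    have "e k (insert a (S - {i} - {j})) (t j i k) = - e k (insert a (S - {i} - {j})) (t i j k)"
      if k: "k \<in> S - {i} - {j}" for k
      using linear_on_minus[OF linear_e'[OF S' k] subspace_V_insert tV(1)[OF ij k]]
        chain3D(2)[OF t(1) ij k] S by auto
    then show "Y j i = - Y i j"
      using zij(2) by (simp add: Y_def sum_negf)
  qed
  have "\<exists>r. \<forall>y\<in>img R. r y \<in> V R \<and> e a (insert a R) (r y) = y \<and> r (- y) = - r y" if R: "idx R" for R
    using ex_odd_section[OF linear_e_a[OF R] subspace_V'[OF R]] unfolding img_def by metis
  then obtain r where r: "\<And>R y. idx R \<Longrightarrow> y \<in> img R \<Longrightarrow>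
      r R y \<in> V R \<and> e a (insert a R) (r R y) = y \<and> r R (- y) = - r R y"
    by metis
  define u where "u = (\<lambda>i j. r (S - {i} - {j}) (Y i j))"
  have u: "u i j \<in> V (S - {i} - {j})" "e a (insert a (S - {i} - {j})) (u i j) = Y i j" "u j i = - u i j"
    if ij: "i \<in> S" "j \<in> S - {i}" for i j
  proof -
    have S': "idx (S - {i} - {j})" using S by auto
    have [simp]: "S - {j} - {i} = S - {i} - {j}" by blast
    show "u i j \<in> V (S - {i} - {j})" "e a (insert a (S - {i} - {j})) (u i j) = Y i j" "u j i = - u i j"
      unfolding u_def using r[OF S' Y(1)[OF ij]] Y(2)[OF ij] by simp_all
  qed
  define T where "T = (\<lambda>i j k. if i = a then u j k else if j = a then - u i k
    else if k = a then u i j else t i j k)"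
  have Sa: "insert a S - {a} = S" using aS by simp
  have T: "chain3 V (insert a S) T"
    unfolding chain3_def
  proof (intro ballI)
    fix i j k assume ijk: "i \<in> insert a S" "j \<in> insert a S - {i}" "k \<in> insert a S - {i} - {j}"
    consider "i = a" "j \<in> S" "k \<in> S - {j}" "k \<noteq> a" "j \<noteq> a"
      | "j = a" "i \<in> S" "k \<in> S - {i}" "k \<noteq> a" "i \<noteq> a"
      | "k = a" "i \<in> S" "j \<in> S - {i}" "i \<noteq> a" "j \<noteq> a"
      | "i \<noteq> a" "j \<noteq> a" "k \<noteq> a" "i \<in> S" "j \<in> S - {i}" "k \<in> S - {i} - {j}"
      using ijk by auto
    then show "T i j k \<in> V (insert a S - {i} - {j} - {k}) \<and> T j i k = - T i j k \<and> T i k j = - T i j k"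
    proof cases
      case 1
      then show ?thesis using u[of j k] Sa by (simp add: T_def)
    next
      case 2
      have "insert a S - {i} - {j} - {k} = S - {i} - {k}" using 2 aS by auto
      moreover have "subspace (V (S - {i} - {k}))" using S by (intro subspace_V') auto
      ultimately show ?thesis using u[of i k] 2 by (simp add: T_def subspace_neg)
    next
      case 3
      have "insert a S - {i} - {j} - {k} = S - {i} - {j}" using 3 aS by auto
      then show ?thesis using u[of i j] 3 by (simp add: T_def)
    next
      case 4
      have "insert a S - {i} - {j} - {k} = insert a (S - {i} - {j} - {k})" using 4 by auto
      then show ?thesis using tV(1)[of i j k] chain3D(2,3)[OF t(1), of i j k] 4 by (simp add: T_def)
    qed
  qed
  have zT: "z i j = bd e (insert a S - {i} - {j}) (T i j)" if ij: "i \<in> S" "j \<in> S - {i}" for i j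
  proof -
    have ne: "i \<noteq> a" "j \<noteq> a" using ij aS by auto
    have "bd e (insert a (S - {i} - {j})) (T i j) =
        e a (insert a (S - {i} - {j})) (T i j a) +
        (\<Sum>k\<in>S - {i} - {j}. e k (insert a (S - {i} - {j})) (T i j k))"
      using S by (intro bd_insert) auto
    also have "(\<Sum>k\<in>S - {i} - {j}. e k (insert a (S - {i} - {j})) (T i j k)) =
        (\<Sum>k\<in>S - {i} - {j}. e k (insert a (S - {i} - {j})) (t i j k))"
      using ne aS by (intro sum.cong) (auto simp: T_def)
    also have "e a (insert a (S - {i} - {j})) (T i j a) = Y i j"
      using u(2)[OF ij] ne by (simp add: T_def)
    finally show ?thesis using D2[OF ij] by (simp add: Y_def)
  qed
  \<comment> \<open>Subtracting from \<open>z i\<close> the boundary of \<open>T i\<close> leaves a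
    1-chain with zero boundary whose only possibly nonzero entry is at \<open>a\<close>. Hence
    \<open>e a\<close> kills this entry, which without injectivity need not be zero.\<close>
  have "e a (insert a (S - {i})) (z i a - bd e (S - {i}) (T i a)) = 0" if i: "i \<in> S" for i
  proof -
    note D = insert_a_Diff[OF S i]
    have ia: "insert a (S - {i}) - {a} = S - {i}" using aS by auto
    have fin: "finite (insert a (S - {i}))" "insert a (S - {i}) \<subseteq> U" using S a by auto
    have Ti: "chain2 V (insert a (S - {i})) (T i)"
      using chain3_chain2[OF T, of i] i D by simp
    have zi: "chain1 V (insert a (S - {i})) (z i)"
      using chain2_chain1[OF z, of i] i D by simp
    have Ti1: "chain1 V (insert a (S - {i})) (\<lambda>j. bd e (insert a (S - {i}) - {j}) (T i j))"
      unfolding chain1_def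
    proof
      fix j assume "j \<in> insert a (S - {i})"
      then show "bd e (insert a (S - {i}) - {j}) (T i j) \<in> V (insert a (S - {i}) - {j})"
        using fin by (intro bd_mem chain2_chain1[OF Ti]) auto
    qed
    have "0 = bd e (insert a (S - {i})) (\<lambda>j. z i j - bd e (insert a (S - {i}) - {j}) (T i j))"
      unfolding bd_diff[OF fin zi Ti1] bd_bd_eq_0[OF fin Ti] using z0[OF i] D by simp
    also have "\<dots> = e a (insert a (S - {i})) (z i a - bd e (S - {i}) (T i a)) +
        (\<Sum>j\<in>S - {i}. e j (insert a (S - {i})) (z i j - bd e (insert a (S - {i}) - {j}) (T i j)))"
      using S ia by (subst bd_insert) auto
    also have "(\<Sum>j\<in>S - {i}. e j (insert a (S - {i})) (z i j - bd e (insert a (S - {i}) - {j}) (T i j))) = 0"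
    proof (intro sum.neutral ballI)
      fix j assume "j \<in> S - {i}"
      then show "e j (insert a (S - {i})) (z i j - bd e (insert a (S - {i}) - {j}) (T i j)) = 0"
        using zT[OF i, of j] D fin e_0[of "insert a (S - {i})" j] by simp
    qed
    finally show ?thesis by simp
  qed
  with T zT show ?thesis using that by blast
qed

text \<open>A kernel element \<open>v\<close>, placed at \<open>a\<close>, is a 1-cycle at
  \<open>insert a S\<close>, so it is the boundary of some \<open>z\<close>. Up to entries in
  kernels, \<open>z\<close> is itself a boundary \<open>y\<close>. The boundary over
  \<open>S\<close> of \<open>y a\<close> is zero, and by \<open>ker_e_indep\<close> that of the
  kernel entries is zero as well, so \<open>v = 0\<close>.\<close>

lemma injective_e_a:
  assumes S: "idx S" and ex2: "exact2 dV de S" and ex1: "exact1 V e (insert a S)"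
    and v: "v \<in> V S" "e a (insert a S) v = 0"
  shows "v = 0"
proof -
  have aS: "a \<notin> S" using S by auto
  note fin = idx_simps[OF S]
  define x where "x = (\<lambda>i. if i = a then v else 0)"
  have "chain1 V (insert a S) x"
    using v fin(6) subspace_0[OF subspace_V_Diff[OF fin(4,5)]] by (auto simp: chain1_def x_def)
  moreover have "bd e (insert a S) x = 0"
    using v fin e_0[OF fin(4,5)] aS by (subst bd_insert) (auto simp: x_def intro!: sum.neutral)
  ultimately obtain z where z: "chain2 V (insert a S) z"
      "\<And>i. i \<in> insert a S \<Longrightarrow> x i = bd e (insert a S - {i}) (z i)"
    using ex1 unfolding exact1_def by blast
  \<comment> \<open>At \<open>a\<close> the boundary of \<open>z\<close> is \<open>v\<close>, so the
    cycle condition is available at the points of \<open>S\<close> only.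
    \<open>correct_chain2\<close> is stated with this weaker condition for that reason.\<close>
  have "bd e (insert a S - {i}) (z i) = 0" if "i \<in> S" for i
    using z(2)[of i] that aS by (cases "i = a") (auto simp: x_def)
  then obtain T where T: "chain3 V (insert a S) T"
    "\<And>i. i \<in> S \<Longrightarrow> e a (insert a (S - {i})) (z i a - bd e (S - {i}) (T i a)) = 0"
    using correct_chain2[OF S ex2 z(1)] by metis
  define y where "y = (\<lambda>i j. bd e (insert a S - {i} - {j}) (T i j))"
  have y: "chain2 V (insert a S) y" unfolding y_def by (rule chain2_bd[OF fin(4,5) T(1)])
  have Sa: "insert a S - {a} = S" using aS by simp
  have Ta: "chain2 V S (T a)" using chain3_chain2[OF T(1), of a] Sa by simp
  have za: "chain1 V S (z a)" and ya: "chain1 V S (y a)"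
    using chain2_chain1[OF z(1), of a] chain2_chain1[OF y, of a] Sa by auto
  have "v = bd e S (z a)" using z(2)[of a] Sa by (simp add: x_def)
  \<comment> \<open>\<open>y a\<close> is the boundary of the 2-chain \<open>T a\<close>, so its own
    boundary is zero.\<close>
  also have "\<dots> = bd e S (z a) - bd e S (y a)"
    using bd_bd_eq_0[OF fin(1,2) Ta] by (simp add: y_def Sa)
  also have "\<dots> = bd e S (\<lambda>i. z a i - y a i)"
    by (rule bd_diff[OF fin(1,2) za ya, symmetric])
  also have "\<dots> = 0"
    unfolding bd_def
  proof (intro sum.neutral ballI)
    fix i assume i: "i \<in> S"
    have "insert a S - {i} - {a} = S - {i}" using aS by auto
    then have ia: "z i a - y i a \<in> V (S - {i})" "z a i - y a i = - (z i a - y i a)"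
        "y i a = bd e (S - {i}) (T i a)"
      using chain2D[OF chain2_diff[OF fin(4,5) z(1) y], of i a] i aS by (auto simp: y_def)
    have "finite (S - {i})" "S - {i} \<subseteq> U" "a \<in> U - (S - {i})" "i \<in> U - (S - {i})"
      using S a i by auto
    moreover have "e a (insert a (S - {i})) (z i a - y i a) = 0"
      using T(2)[OF i] ia(3) by simp
    ultimately have "e i (insert i (S - {i})) (z i a - y i a) = 0"
      using ker_e_indep[of "S - {i}" a i "z i a - y i a"] ia(1) by blast
    then have "e i S (z i a - y i a) = 0" using i by (simp add: insert_absorb)
    then show "e i S (z a i - y a i) = 0"
      using e_minus[OF fin(1,2) i ia(1)] ia(2) by simp
  qed
  finally show ?thesis .
qed

text \<open>Injectivity on the sets \<open>S - {i}\<close> removes the error that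
  \<open>correct_chain2\<close> leaves in the entries \<open>z i a\<close>. Antisymmetry then
  settles the entries \<open>z a i\<close>.\<close>

lemma exact2_insert:
  assumes S: "idx S" and ex2: "exact2 dV de S"
    and inj: "\<And>i v. i \<in> S \<Longrightarrow> v \<in> V (S - {i}) \<Longrightarrow> e a (insert a (S - {i})) v = 0 \<Longrightarrow> v = 0"
  shows "exact2 V e (insert a S)"
  unfolding exact2_def
proof (intro allI impI)
  fix z assume z: "chain2 V (insert a S) z" "\<forall>i\<in>insert a S. bd e (insert a S - {i}) (z i) = 0"
  have aS: "a \<notin> S" using S by auto
  note fin = idx_simps[OF S]
  have z0: "bd e (insert a S - {i}) (z i) = 0" if "i \<in> S" for i using z(2) that by blast
  obtain T where T: "chain3 V (insert a S) T"
    "\<And>i j. i \<in> S \<Longrightarrow> j \<in> S - {i} \<Longrightarrow> z i j = bd e (insert a S - {i} - {j}) (T i j)"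
    "\<And>i. i \<in> S \<Longrightarrow> e a (insert a (S - {i})) (z i a - bd e (S - {i}) (T i a)) = 0"
    using correct_chain2[OF S ex2 z(1) z0] by blast
  define y where "y = (\<lambda>i j. bd e (insert a S - {i} - {j}) (T i j))"
  have y: "chain2 V (insert a S) y" unfolding y_def by (rule chain2_bd[OF fin(4,5) T(1)])
  have ia: "z i a = y i a" if i: "i \<in> S" for i
  proof -
    have D: "insert a S - {i} - {a} = S - {i}" using aS by auto
    then have "z i a - y i a \<in> V (S - {i})"
      using chain2D(1)[OF chain2_diff[OF fin(4,5) z(1) y], of i a] i aS by auto
    then show ?thesis using inj[OF i, of "z i a - y i a"] T(3)[OF i] D by (simp add: y_def)
  qed
  have "z i j = y i j" if ij: "i \<in> insert a S" "j \<in> insert a S - {i}" for i j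
  proof -
    consider "i = a" "j \<in> S" | "i \<in> S" "j = a" | "i \<in> S" "j \<in> S - {i}" using ij by auto
    then show ?thesis
    proof cases
      case 1
      then show ?thesis
        using ia[of j] chain2D(2)[OF z(1), of j i] chain2D(2)[OF y, of j i] aS by (cases "j = a") auto
    qed (use ia T(2) in \<open>auto simp: y_def\<close>)
  qed
  then show "\<exists>t. chain3 V (insert a S) t \<and> (\<forall>i\<in>insert a S. \<forall>j\<in>insert a S - {i}. z i j = bd e (insert a S - {i} - {j}) (t i j))"
    using T(1) unfolding y_def by blast
qed

end

subsection \<open>Dimensions\<close>

context vector_space
begin

lemma fin_dim_linear_on_inj_iff:
  assumes f: "linear_on scale scale V W f" and V: "subspace V" and inj: "inj_on f V"
  shows "fin_dim scale (f ` V) \<longleftrightarrow> fin_dim scale V"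
proof
  assume fd: "fin_dim scale (f ` V)"
  have g: "the_inv_into V f (f v) = v" if "v \<in> V" for v
    by (rule the_inv_into_f_f[OF inj that])
  have "linear_on scale scale (f ` V) V (the_inv_into V f)"
    unfolding linear_on_def
  proof (intro conjI ballI allI)
    fix u v assume "u \<in> f ` V" "v \<in> f ` V"
    then obtain x y where "x \<in> V" "u = f x" "y \<in> V" "v = f y" by blast
    then show "the_inv_into V f (u + v) = the_inv_into V f u + the_inv_into V f v"
      using g subspace_add[OF V] linear_on_add[OF f V] by metis
  next
    fix c v assume "v \<in> f ` V"
    then obtain y where "y \<in> V" "v = f y" by blast
    then show "the_inv_into V f (c *s v) = c *s the_inv_into V f v"
      using g subspace_scale[OF V] linear_on_scale[OF f V] by metis
  qed (use g in auto)
  then have "fin_dim scale (the_inv_into V f ` f ` V)"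
    using fin_dim_linear_on_image subspace_linear_on_image[OF f V] fd by blast
  then show "fin_dim scale V" using g by (simp add: image_image)
qed (use fin_dim_linear_on_image[OF f V] in blast)

lemma fin_dim_0: "fin_dim scale {0}" and dim_0: "dim {0} = 0"
proof -
  show "fin_dim scale {0}" unfolding fin_dim_def by (intro exI[of _ "{}"]) simp
  show "dim {0} = 0" using dim_le_card[of "{0}" "{}"] by simp
qed

end

context subset_module
begin

text \<open>Exactness in degree 0 expresses \<open>V S\<close> through proper subsets of
  \<open>S\<close>, and at the empty set the sum is empty. This is the base case
  \<open>N = 0\<close> of both inductions below.\<close>

lemma V_eq_0:
  assumes ex: "\<And>S. finite S \<Longrightarrow> S \<subseteq> U \<Longrightarrow> exact0 V e S"
  shows "finite S \<Longrightarrow> S \<subseteq> U \<Longrightarrow> V S = {0}"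
proof (induction S rule: finite_psubset_induct)
  case (psubset S)
  have "v = 0" if v: "v \<in> V S" for v
  proof -
    obtain x where x: "chain1 V S x" "v = bd e S x"
      using ex[OF psubset.hyps(1) psubset.prems] v unfolding exact0_def by blast
    have "x i = 0" if i: "i \<in> S" for i
    proof -
      have "V (S - {i}) = {0}" using i psubset.prems by (intro psubset.IH) auto
      moreover have "x i \<in> V (S - {i})" using x(1) i by (simp add: chain1_def)
      ultimately show ?thesis by blast
    qed
    then show ?thesis using x(2) psubset.hyps psubset.prems by (simp add: bd_def e_0)
  qed
  moreover have "0 \<in> V S" using subspace_0[OF subspace_V] psubset by blast
  ultimately show ?case by blast
qed

text \<open>The set \<open>S\<close> is moved to \<open>S'\<close> by renaming one point at a time.
  Each renaming is an isomorphism, with inverse given by \<open>swap_swap\<close>.\<close>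

lemma fin_dim_dim_card:
  assumes "finite S" "S \<subseteq> U" "finite S'" "S' \<subseteq> U" "card S = card S'"
  shows "(fin_dim scale (V S) \<longleftrightarrow> fin_dim scale (V S')) \<and>
    (fin_dim scale (V S) \<longrightarrow> dim (V S) = dim (V S'))"
  using assms
proof (induction "card (S - S')" arbitrary: S)
  case 0
  then have "S = S'" by (metis card_0_eq card_subset_eq finite_Diff Diff_eq_empty_iff)
  then show ?case by simp
next
  case (Suc n)
  then have "S - S' \<noteq> {}" by force
  then obtain i where i: "i \<in> S" "i \<notin> S'" by blast
  have "S' - S \<noteq> {}"
    using i Suc.prems card_subset_eq[of S S'] by (metis Diff_eq_empty_iff)
  then obtain j where j: "j \<in> S'" "j \<notin> S" by blast
  define R where "R = S - {i}"
  have R: "finite R" "R \<subseteq> U" "i \<in> U - R" "j \<in> U - R" "S = insert i R"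
    using i j Suc.prems by (auto simp: R_def)
  have "insert j R - S' = (S - S') - {i}" using R i j by auto
  then have "n = card (insert j R - S')" using Suc.hyps(2) i Suc.prems by simp
  moreover have "card (insert j R) = card S" using R by simp
  ultimately have IH: "(fin_dim scale (V (insert j R)) \<longleftrightarrow> fin_dim scale (V S')) \<and>
    (fin_dim scale (V (insert j R)) \<longrightarrow> dim (V (insert j R)) = dim (V S'))"
    using Suc.hyps(1)[of "insert j R"] Suc.prems R by auto
  note lin = linear_swap[OF R(1-4)]
  have sub: "subspace (V S)" using subspace_V Suc.prems by blast
  have inj: "inj_on (\<theta> i j R) (V S)"
    using swap_swap[OF R(1-4)] R(5) by (metis inj_on_inverseI)
  have "v \<in> \<theta> i j R ` V S" if "v \<in> V (insert j R)" for v
    using swap_swap[OF R(1,2,4,3) that] swap_mem[OF R(1,2,4,3) that] R(5) by (metis imageI)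
  then have im: "\<theta> i j R ` V S = V (insert j R)"
    using swap_mem[OF R(1-4)] R(5) by auto
  have lin': "linear_on scale scale (V S) (V (insert j R)) (\<theta> i j R)" using lin R(5) by simp
  show ?case
    using IH fin_dim_linear_on_inj_iff[OF lin' sub inj] fin_dim_linear_on_image[OF lin' sub] inj im
    by auto
qed

end

context subset_module_derivative
begin

text \<open>\<open>V (insert a S)\<close> is the direct sum of \<open>img S\<close>, a copy of
  \<open>V S\<close> by injectivity, and the complement \<open>dV S\<close>.\<close>

lemma dim_derivative:
  assumes S: "idx S" and inj: "\<And>v. v \<in> V S \<Longrightarrow> e a (insert a S) v = 0 \<Longrightarrow> v = 0"
  shows "fin_dim scale (V (insert a S)) \<longleftrightarrow> fin_dim scale (V S) \<and> fin_dim scale (dV S)"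
    and "fin_dim scale (V (insert a S)) \<Longrightarrow> dim (V (insert a S)) = dim (V S) + dim (dV S)"
proof -
  note lin = linear_e_a[OF S] and sub = subspace_V'[OF S]
  have inj': "inj_on (e a (insert a S)) (V S)"
  proof (rule inj_onI)
    fix u v assume uv: "u \<in> V S" "v \<in> V S" "e a (insert a S) u = e a (insert a S) v"
    then have "u - v = 0"
      using inj[of "u - v"] subspace_diff[OF sub] linear_on_diff[OF lin sub] by simp
    then show "u = v" by simp
  qed
  have int: "img S \<inter> dV S \<subseteq> {0}"
    using P_dV[OF S] P_eq_0_iff[OF S] dV_subset[OF S] by fastforce
  have sum: "\<exists>u\<in>img S. \<exists>w\<in>dV S. v = u + w" if "v \<in> V (insert a S)" for v
    using diff_P_mem[OF S that] P_in_dV[OF S that] by (metis diff_add_cancel)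
  note ds = dim_direct_sum[OF subspace_V_insert[OF S] subspace_img[OF S] img_subset[OF S]
      subspace_dV[OF S] dV_subset[OF S] int sum]
  have fd: "fin_dim scale (img S) \<longleftrightarrow> fin_dim scale (V S)"
    unfolding img_def by (rule fin_dim_linear_on_inj_iff[OF lin sub inj'])
  with ds(1) show *: "fin_dim scale (V (insert a S)) \<longleftrightarrow> fin_dim scale (V S) \<and> fin_dim scale (dV S)"
    by blast
  assume "fin_dim scale (V (insert a S))"
  then show "dim (V (insert a S)) = dim (V S) + dim (dV S)"
    using ds(2) fin_dim_linear_on_image[OF lin sub] inj' * by (auto simp: img_def)
qed

end

text \<open>The bound doubles because exactness in degree 2 loses two degrees with each derivative.\<close>

lemma exact2_and_injective:
  assumes "subset_module s U V e \<theta>"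
    and "\<And>S. finite S \<Longrightarrow> S \<subseteq> U \<Longrightarrow> N \<le> card S \<Longrightarrow> exact0 V e S \<and> exact1 V e S"
  shows "(\<forall>S. finite S \<longrightarrow> S \<subseteq> U \<longrightarrow> 2 * N \<le> card S \<longrightarrow> exact2 V e S) \<and>
    (\<forall>a S v. a \<in> U \<longrightarrow> finite S \<longrightarrow> S \<subseteq> U - {a} \<longrightarrow> 2 * N \<le> card S + 2 \<longrightarrow>
      v \<in> V S \<longrightarrow> e a (insert a S) v = 0 \<longrightarrow> v = 0)"
  using assms
proof (induction N arbitrary: U V e \<theta>)
  case 0
  interpret subset_module s U V e \<theta> by fact
  have V0: "V S = {0}" if "finite S" "S \<subseteq> U" for S
    using V_eq_0[OF _ that] 0(2) by blast
  have "exact2 V e S" if S: "finite S" "S \<subseteq> U" for S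
    unfolding exact2_def
  proof (intro allI impI)
    fix z assume z: "chain2 V S z"
    have "bd e (S - {i} - {j}) (\<lambda>_. 0) = 0" for i j
      using S e_0[of "S - {i} - {j}"] by (auto simp: bd_def intro!: sum.neutral)
    moreover have "V (S - {i} - {j}) = {0}" for i j using S by (intro V0) auto
    then have "z i j = 0" if "i \<in> S" "j \<in> S - {i}" for i j
      using chain2D(1)[OF z that] by simp
    moreover have "0 \<in> V (S - {i} - {j} - {k})" for i j k
      using S by (intro subspace_0 subspace_V) auto
    then have "chain3 V S (\<lambda>_ _ _. 0)"
      by (simp add: chain3_def)
    ultimately show "\<exists>t. chain3 V S t \<and> (\<forall>i\<in>S. \<forall>j\<in>S - {i}. z i j = bd e (S - {i} - {j}) (t i j))"
      by (intro exI[of _ "\<lambda>_ _ _. 0"]) simp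
  qed
  moreover have "v = 0" if "finite S" "S \<subseteq> U - {a}" "v \<in> V S" for a S v
    using V0[of S] that by blast
  ultimately show ?case by blast
next
  case (Suc N)
  interpret subset_module s U V e \<theta> by fact
  have ex2: "exact2 (subset_module_derivative.dV s V e a) (subset_module_derivative.de s V e a) S"
    if a: "a \<in> U" and S: "finite S" "S \<subseteq> U - {a}" "2 * N \<le> card S" for a S
  proof -
    interpret D: subset_module_derivative s U V e \<theta> a by unfold_locales fact
    have "exact0 D.dV D.de S \<and> exact1 D.dV D.de S"
      if S: "finite S" "S \<subseteq> U - {a}" "N \<le> card S" for S
    proof -
      have "a \<notin> S" using S by auto
      then have "exact0 V e (insert a S) \<and> exact1 V e (insert a S)"
        using Suc.prems(2)[of "insert a S"] S a by auto
      then show ?thesis using D.exact0_derivative D.exact1_derivative S by blast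
    qed
    then show ?thesis using Suc.IH[OF D.derivative] S by blast
  qed
  have inj: "v = 0"
    if a: "a \<in> U" and S: "finite S" "S \<subseteq> U - {a}" "2 * N \<le> card S"
      and v: "v \<in> V S" "e a (insert a S) v = 0" for a S v
  proof -
    interpret D: subset_module_derivative s U V e \<theta> a by unfold_locales fact
    have "a \<notin> S" using S by auto
    then have "exact1 V e (insert a S)"
      using Suc.prems(2)[of "insert a S"] S a by auto
    then show ?thesis using D.injective_e_a[of S v] ex2[OF a S] S v by blast
  qed
  \<comment> \<open>Two points are lost here: one is \<open>a\<close>, and the other is the
    \<open>i\<close> in \<open>R - {i}\<close>, which must still have \<open>2 * N\<close> elements
    for \<open>inj\<close> to apply.\<close>
  have "exact2 V e S" if S: "finite S" "S \<subseteq> U" "2 * Suc N \<le> card S" for S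
  proof -
    have "S \<noteq> {}" using S(3) by auto
    then obtain a where a: "a \<in> S" by blast
    then interpret D: subset_module_derivative s U V e \<theta> a using S by unfold_locales auto
    define R where "R = S - {a}"
    have R: "S = insert a R" "finite R" "R \<subseteq> U - {a}" "2 * N + 1 \<le> card R"
      using S a by (auto simp: R_def card_Diff_singleton)
    have "v = 0" if "i \<in> R" "v \<in> V (R - {i})" "e a (insert a (R - {i})) v = 0" for i v
      using that R(2-4) by (intro inj[OF D.a _ _ _ that(2,3)]) (auto simp: card_Diff_singleton)
    then show ?thesis
      using D.exact2_insert[of R] ex2[of a R] R D.a by simp
  qed
  with inj show ?case by auto
qed

text \<open>Binomial coefficients form the convenient basis: by Pascal's rule, summing a difference
  given by \<open>n choose k\<close> yields \<open>n choose Suc k\<close>, so passing from the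
  derivative to \<open>V\<close> merely shifts the coefficients, as in \<open>c'\<close>.\<close>

lemma dim_dichotomy:
  assumes "subset_module s U V e \<theta>" "infinite U"
    and "\<And>S. finite S \<Longrightarrow> S \<subseteq> U \<Longrightarrow> N \<le> card S \<Longrightarrow> exact0 V e S \<and> exact1 V e S"
  shows "(\<forall>S. finite S \<longrightarrow> S \<subseteq> U \<longrightarrow> 2 * N \<le> card S + 1 \<longrightarrow> \<not> fin_dim s (V S)) \<or>
    (\<exists>K (c :: nat \<Rightarrow> rat). \<forall>S. finite S \<longrightarrow> S \<subseteq> U \<longrightarrow> 2 * N \<le> card S + 1 \<longrightarrow>
      fin_dim s (V S) \<and> of_nat (vector_space.dim s (V S)) = (\<Sum>k<K. c k * of_nat (card S choose k)))"
  using assms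
proof (induction N arbitrary: U V e \<theta>)
  case 0
  interpret subset_module s U V e \<theta> by fact
  have V0: "V S = {0}" if "finite S" "S \<subseteq> U" for S
    using V_eq_0[OF _ that] 0(3) by blast
  then show ?case
    using fin_dim_0 dim_0 by (intro disjI2 exI[of _ 0]) simp
next
  case (Suc N)
  interpret subset_module s U V e \<theta> by fact
  obtain a where a: "a \<in> U" using Suc.prems(2) by (metis finite.emptyI ex_in_conv)
  interpret D: subset_module_derivative s U V e \<theta> a by unfold_locales fact
  have "exact0 D.dV D.de S \<and> exact1 D.dV D.de S"
    if S: "finite S" "S \<subseteq> U - {a}" "N \<le> card S" for S
  proof -
    have "a \<notin> S" using S by auto
    then have "exact0 V e (insert a S) \<and> exact1 V e (insert a S)"
      using Suc.prems(3)[of "insert a S"] S a by auto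
    then show ?thesis using D.exact0_derivative D.exact1_derivative S by blast
  qed
  note IH = Suc.IH[OF D.derivative _ this]
  have inf: "infinite (U - {a})" using Suc.prems(2) by simp
  have inj: "v = 0" if "finite S" "S \<subseteq> U - {a}" "2 * N \<le> card S" "v \<in> V S" "e a (insert a S) v = 0" for S v
    using exact2_and_injective[OF Suc.prems(1,3)] that a by auto
  \<comment> \<open>One set of each size avoiding \<open>a\<close> suffices, as dimensions depend on
    the size only. The functor is thereby replaced by a sequence indexed by
    \<open>n\<close>.\<close>
  have "\<exists>T. finite T \<and> card T = n \<and> T \<subseteq> U - {a}" for n
    using infinite_arbitrarily_large[OF inf] by blast
  then obtain T where T: "\<And>n. finite (T n)" "\<And>n. card (T n) = n" "\<And>n. T n \<subseteq> U - {a}"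
    by metis
  have T_U: "T n \<subseteq> U" for n using T(3) by blast
  have V_T: "(fin_dim s (V S) \<longleftrightarrow> fin_dim s (V (T (card S)))) \<and>
      (fin_dim s (V S) \<longrightarrow> dim (V S) = dim (V (T (card S))))" if "finite S" "S \<subseteq> U" for S
    using fin_dim_dim_card[OF that T(1) T_U] T(2) by simp
  have dim_T: "fin_dim s (V (T (Suc n))) \<longleftrightarrow> fin_dim s (V (T n)) \<and> fin_dim s (D.dV (T n))"
      "fin_dim s (V (T (Suc n))) \<longrightarrow> dim (V (T (Suc n))) = dim (V (T n)) + dim (D.dV (T n))"
    if n: "2 * N \<le> n" for n
  proof -
    have "a \<notin> T n" using T(3) by blast
    then have c: "card (insert a (T n)) = Suc n" using T(1,2) by simp
    have *: "(fin_dim s (V (insert a (T n))) \<longleftrightarrow> fin_dim s (V (T (Suc n)))) \<and>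
      (fin_dim s (V (insert a (T n))) \<longrightarrow> dim (V (insert a (T n))) = dim (V (T (Suc n))))"
      using V_T[of "insert a (T n)"] T(1) T_U a unfolding c by simp
    have T': "finite (T n) \<and> T n \<subseteq> U - {a}" using T by blast
    have i: "v = 0" if "v \<in> V (T n)" "e a (insert a (T n)) v = 0" for v
      using inj[OF _ _ _ that] T n by simp
    note d = D.dim_derivative[OF T' i]
    show "fin_dim s (V (T (Suc n))) \<longleftrightarrow> fin_dim s (V (T n)) \<and> fin_dim s (D.dV (T n))"
      "fin_dim s (V (T (Suc n))) \<longrightarrow> dim (V (T (Suc n))) = dim (V (T n)) + dim (D.dV (T n))"
      using d * by auto
  qed
  \<comment> \<open>Injectivity already holds at \<open>2 * N\<close>, but the step from
    \<open>2 * N\<close> to \<open>m\<close> is used to deduce that the derivative is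
    finite-dimensional.\<close>
  define m where "m = 2 * N + 1"
  show ?case
  proof (cases "\<exists>n\<ge>m. fin_dim s (V (T n))")
    case False
    then have "\<not> fin_dim s (V S)" if "finite S" "S \<subseteq> U" "2 * Suc N \<le> card S + 1" for S
      using V_T[OF that(1,2)] that(3) by (auto simp: m_def)
    then show ?thesis by blast
  next
    case True
    then obtain n where n: "n \<ge> m" "fin_dim s (V (T n))" by blast
    \<comment> \<open>Finite dimension passes down from \<open>n\<close> to \<open>m\<close> along
      the injective maps.\<close>
    have m: "fin_dim s (V (T m))"
      using n by (induction n rule: dec_induct) (auto simp: dim_T m_def)
    \<comment> \<open>The size \<open>2 * N\<close> lies in the range of the induction hypothesis,
      so this single value excludes its infinite alternative.\<close>
    then have "fin_dim s (D.dV (T (2 * N)))" using dim_T(1)[of "2 * N"] by (simp add: m_def)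
    then obtain K and c :: "nat \<Rightarrow> rat" where c: "\<And>S. finite S \<Longrightarrow> S \<subseteq> U - {a} \<Longrightarrow> 2 * N \<le> card S + 1 \<Longrightarrow>
      fin_dim s (D.dV S) \<and> of_nat (dim (D.dV S)) = (\<Sum>k<K. c k * of_nat (card S choose k))"
      using IH[OF inf] T(1)[of "2 * N"] T(2)[of "2 * N"] T(3)[of "2 * N"] by fastforce
    \<comment> \<open>The constant of summation, fixed by the value at the starting point
      \<open>m\<close>.\<close>
    define C :: rat where "C = of_nat (dim (V (T m))) - (\<Sum>k<K. c k * of_nat (m choose Suc k))"
    have *: "fin_dim s (V (T n)) \<and> of_nat (dim (V (T n))) = C + (\<Sum>k<K. c k * of_nat (n choose Suc k))"
      if "m \<le> n" for n
      using that
    proof (induction n rule: dec_induct)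
      case base
      then show ?case using m by (simp add: C_def)
    next
      case (step n)
      have n: "2 * N \<le> n" using step.hyps by (simp add: m_def)
      have W: "fin_dim s (D.dV (T n))" "of_nat (dim (D.dV (T n))) = (\<Sum>k<K. c k * of_nat (n choose k))"
        using c[of "T n"] T n by auto
      have fd: "fin_dim s (V (T (Suc n)))" using dim_T(1)[OF n] step.IH W by blast
      then have "dim (V (T (Suc n))) = dim (V (T n)) + dim (D.dV (T n))"
        using dim_T(2)[OF n] by blast
      then show ?case
        using fd step.IH W(2) by (simp add: sum.distrib distrib_left)
    qed
    define c' where "c' = (\<lambda>k. case k of 0 \<Rightarrow> C | Suc k \<Rightarrow> c k)"
    have "fin_dim s (V S) \<and> of_nat (dim (V S)) = (\<Sum>k<Suc K. c' k * of_nat (card S choose k))"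
      if S: "finite S" "S \<subseteq> U" "2 * Suc N \<le> card S + 1" for S
      using V_T[OF S(1,2)] *[of "card S"] S(3)
      unfolding sum.lessThan_Suc_shift by (simp add: c'_def m_def)
    then show ?thesis by blast
  qed
qed

text \<open>\<open>n choose k\<close> is the falling factorial of \<open>n\<close> divided by
  \<open>k!\<close>, whence the rational coefficients.\<close>

lemma ex_poly_binomial_sum:
  "\<exists>p :: rat poly. \<forall>n. poly p (of_nat n) = (\<Sum>k<K. c k * of_nat (n choose k))"
proof -
  define q :: "nat \<Rightarrow> rat poly" where
    "q = (\<lambda>k. smult (1 / fact k) (\<Prod>i<k. [:- of_nat i, 1:]))"
  have "poly (q k) (of_nat n) = of_nat (n choose k)" for k n
    by (simp add: q_def poly_prod binomial_gbinomial gbinomial_prod_rev atLeast0LessThan)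
  then show ?thesis
    by (intro exI[of _ "\<Sum>k<K. smult (c k) (q k)"]) (simp add: poly_sum)
qed

subsection \<open>Permutations from enumerations\<close>

definition numbering :: "nat set \<Rightarrow> nat \<Rightarrow> nat" where
  "numbering S = (SOME f. bij_betw f {1..card S} S)"

lemma bij_numbering: "finite S \<Longrightarrow> card S = n \<Longrightarrow> bij_betw (numbering S) {1..n} S"
  unfolding numbering_def using someI_ex[OF ex_bij_betw_nat_finite_1[of S]] by blast

text \<open>The permutation comparing two enumerations \<open>f\<close> and \<open>g\<close> of the
  same set, that is \<open>f\<close> followed by the inverse of \<open>g\<close>. It is extended by
  the identity to be a permutation in the sense of \<open>permutes\<close>.\<close>

definition quo :: "nat \<Rightarrow> (nat \<Rightarrow> nat) \<Rightarrow> (nat \<Rightarrow> nat) \<Rightarrow> nat \<Rightarrow> nat" where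
  "quo n g f = (\<lambda>x. if x \<in> {1..n} then inv_into {1..n} g (f x) else x)"

context
  fixes n :: nat and g f :: "nat \<Rightarrow> nat" and S :: "nat set"
  assumes g: "bij_betw g {1..n} S" and f: "bij_betw f {1..n} S"
begin

lemma apply_quo: "x \<in> {1..n} \<Longrightarrow> g (quo n g f x) = f x"
  using bij_betwE[OF f] bij_betw_inv_into_right[OF g] by (simp add: quo_def)

lemma quo_permutes: "quo n g f permutes {1..n}"
proof (rule bij_imp_permutes)
  have "bij_betw (inv_into {1..n} g \<circ> f) {1..n} {1..n}"
    by (rule bij_betw_trans[OF f bij_betw_inv_into[OF g]])
  then show "bij_betw (quo n g f) {1..n} {1..n}"
    by (subst bij_betw_cong[of _ _ "inv_into {1..n} g \<circ> f"]) (auto simp: quo_def)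
qed (auto simp: quo_def)

lemma quo_unique:
  assumes p: "p permutes {1..n}" and eq: "\<And>x. x \<in> {1..n} \<Longrightarrow> g (p x) = f x"
  shows "p = quo n g f"
proof
  fix x
  show "p x = quo n g f x"
  proof (cases "x \<in> {1..n}")
    case True
    then have "g (p x) = g (quo n g f x)" using eq apply_quo by simp
    then show ?thesis
      using bij_betw_imp_inj_on[OF g] permutes_in_image[OF p, of x]
        permutes_in_image[OF quo_permutes, of x] True by (auto dest: inj_onD)
  next
    case False
    then show ?thesis using p quo_permutes unfolding permutes_def by metis
  qed
qed

end

lemma bij_betw_comp_permutes: "bij_betw f {1..n} S \<Longrightarrow> p permutes {1..n} \<Longrightarrow> bij_betw (f \<circ> p) {1..n} S"
  by (rule bij_betw_trans[OF permutes_imp_bij])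

lemma bij_betw_upd_Suc:
  assumes "bij_betw f {1..n::nat} R" "i \<notin> R"
  shows "bij_betw (f(Suc n := i)) {1..Suc n} (insert i R)"
proof -
  have "bij_betw (f(Suc n := i)) {1..n} R"
    using assms(1) by (subst bij_betw_cong[of _ _ f]) auto
  moreover have "bij_betw (f(Suc n := i)) {Suc n} {i}" by (simp add: bij_betw_def)
  ultimately have "bij_betw (f(Suc n := i)) ({1..n} \<union> {Suc n}) (R \<union> {i})"
    using assms(2) by (intro bij_betw_combine) auto
  moreover have "{1..n} \<union> {Suc n} = {1..Suc n}" by auto
  ultimately show ?thesis by simp
qed

lemma bij_betw_restrict_Suc:
  assumes f: "bij_betw f {1..Suc n} S"
  shows "bij_betw f {1..n} (S - {f (Suc n)})" "f (Suc n) \<in> S"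
proof -
  show "f (Suc n) \<in> S" using bij_betwE[OF f] by simp
  moreover have "{1..Suc n} - {Suc n} = {1..n}" by auto
  ultimately show "bij_betw f {1..n} (S - {f (Suc n)})"
    using bij_betw_DiffI[OF f, of "{Suc n}" "{f (Suc n)}"] by (simp add: bij_betw_def)
qed

lemma permutes_Suc: "p permutes {1..n} \<Longrightarrow> p permutes {1..Suc n}"
  by (rule permutes_subset) auto

section \<open>The functor on finite sets of naturals attached to a centrally stable
  sequence\<close>

locale central_sequence = vector_space scale
  for scale :: "'a::field \<Rightarrow> 'v::ab_group_add \<Rightarrow> 'v" (infixr \<open>*s\<close> 75) +
  fixes V :: "nat \<Rightarrow> 'v set"
    and \<rho> :: "nat \<Rightarrow> (nat \<Rightarrow> nat) \<Rightarrow> 'v \<Rightarrow> 'v"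
    and \<phi> :: "nat \<Rightarrow> 'v \<Rightarrow> 'v"
    and N :: nat
  assumes coherent: "coherent_sequence scale V \<rho> \<phi>"
    and stable: "centrally_stable_from scale V \<rho> \<phi> N"
begin

lemma N_ge_2: "2 \<le> N"
  using stable by (simp add: centrally_stable_from_def)

context
  fixes n :: nat assumes n: "1 \<le> n"
begin

lemma rep: "sym_rep scale n (V n) (\<rho> n)"
  using coherent n by (simp add: coherent_sequence_def)

lemma subspace_rep: "subspace (V n)"
  using rep by (simp add: sym_rep_def)

lemma linear_rho: "p permutes {1..n} \<Longrightarrow> linear_on scale scale (V n) (V n) (\<rho> n p)"
  using rep by (simp add: sym_rep_def)

lemma rho_mem: "p permutes {1..n} \<Longrightarrow> v \<in> V n \<Longrightarrow> \<rho> n p v \<in> V n"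
  using linear_rho by (simp add: linear_on_def)

lemma rho_id: "v \<in> V n \<Longrightarrow> \<rho> n id v = v"
  using rep by (simp add: sym_rep_def)

lemma rho_comp:
  "p permutes {1..n} \<Longrightarrow> q permutes {1..n} \<Longrightarrow> v \<in> V n \<Longrightarrow> \<rho> n (p \<circ> q) v = \<rho> n p (\<rho> n q v)"
  using rep by (simp add: sym_rep_def)

lemma rho_0: "p permutes {1..n} \<Longrightarrow> \<rho> n p 0 = 0"
  using linear_on_0[OF linear_rho subspace_rep] .

lemma linear_phi: "linear_on scale scale (V n) (V (Suc n)) (\<phi> n)"
  using coherent n by (simp add: coherent_sequence_def)

lemma phi_mem: "v \<in> V n \<Longrightarrow> \<phi> n v \<in> V (Suc n)"
  using linear_phi by (simp add: linear_on_def)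

lemma phi_rho: "p permutes {1..n} \<Longrightarrow> v \<in> V n \<Longrightarrow> \<phi> n (\<rho> n p v) = \<rho> (Suc n) p (\<phi> n v)"
  using coherent n by (simp add: coherent_sequence_def sym_equivariant_def)

end

text \<open>
  \<open>coord S f v\<close> is the class of \<open>(f, v)\<close>, where \<open>f\<close> enumerates \<open>S\<close>, in the space attached to the
  set \<open>S\<close>. It is identified with \<open>V n\<close> by means of the chosen enumeration \<open>numbering S\<close>.
\<close>

definition coord :: "nat set \<Rightarrow> (nat \<Rightarrow> nat) \<Rightarrow> 'v \<Rightarrow> 'v" where
  "coord S f v = \<rho> (card S) (quo (card S) (numbering S) f) v"

context
  fixes S :: "nat set" and n :: nat
  assumes S: "finite S" "card S = n" and n: "1 \<le> n"
begin

lemma linear_coord: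
  "bij_betw f {1..n} S \<Longrightarrow> linear_on scale scale (V n) (V n) (coord S f)"
  unfolding coord_def[abs_def] S(2) by (intro linear_rho[OF n] quo_permutes[OF bij_numbering[OF S]])

lemma coord_mem: "bij_betw f {1..n} S \<Longrightarrow> v \<in> V n \<Longrightarrow> coord S f v \<in> V n"
  using linear_coord by (simp add: linear_on_def)

lemma coord_cong: "(\<And>x. x \<in> {1..n} \<Longrightarrow> f x = g x) \<Longrightarrow> coord S f v = coord S g v"
proof -
  assume "\<And>x. x \<in> {1..n} \<Longrightarrow> f x = g x"
  then have "quo n (numbering S) f = quo n (numbering S) g" by (auto simp: quo_def fun_eq_iff)
  then show ?thesis by (simp add: coord_def S(2))
qed

text \<open>The balancing relation for classes of pairs of an enumeration and a vector: a
  permutation acting on the vector may be moved to the enumeration.\<close>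

lemma coord_rho:
  assumes f: "bij_betw f {1..n} S" and p: "p permutes {1..n}" and v: "v \<in> V n"
  shows "coord S f (\<rho> n p v) = coord S (f \<circ> p) v"
proof -
  note en = bij_numbering[OF S] and fp = bij_betw_comp_permutes[OF f p]
  have "quo n (numbering S) f \<circ> p = quo n (numbering S) (f \<circ> p)"
    using permutes_in_image[OF p]
    by (intro quo_unique[OF en fp] permutes_compose[OF p] quo_permutes[OF en f])
      (simp add: apply_quo[OF en f])
  then show ?thesis
    unfolding coord_def S(2) using rho_comp[OF n quo_permutes[OF en f] p v] by simp
qed

lemma coord_numbering: "v \<in> V n \<Longrightarrow> coord S (numbering S) v = v"
  using quo_unique[OF bij_numbering[OF S] bij_numbering[OF S] permutes_id] rho_id[OF n]
  by (simp add: coord_def S(2))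

end

text \<open>
  Below \<open>N - 1\<close> the maps \<open>\<phi>\<close> need not satisfy the relations of a functor, so the spaces are truncated.
  This does not affect 2-chains on sets with more than \<open>N\<close> elements.
\<close>

definition VV :: "nat set \<Rightarrow> 'v set" where
  "VV S = (if N \<le> card S + 1 then V (card S) else {0})"

text \<open>The added point takes the last position, because \<open>\<phi>\<close> is equivariant
  for exactly the permutations that fix the last letter.\<close>

definition ee :: "nat \<Rightarrow> nat set \<Rightarrow> 'v \<Rightarrow> 'v" where
  "ee i S v = (if N \<le> card S
     then coord S ((numbering (S - {i}))(card S := i)) (\<phi> (card S - 1) v) else 0)"

definition swap :: "nat \<Rightarrow> nat \<Rightarrow> nat set \<Rightarrow> 'v \<Rightarrow> 'v" where
  "swap i j S v = (if N \<le> card S + 2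
     then coord (insert j S) ((id(i := j)) \<circ> numbering (insert i S)) v else 0)"

text \<open>Equivariance of \<open>\<phi>\<close> makes the definition independent of the chosen
  \<open>numbering\<close>. Identities between the maps can then be checked on classes with any
  enumeration.\<close>

lemma ee_coord:
  assumes R: "finite R" "card R = n" "N \<le> Suc n" and i: "i \<notin> R"
    and f: "bij_betw f {1..n} R" and v: "v \<in> V n"
  shows "ee i (insert i R) (coord R f v) = coord (insert i R) (f(Suc n := i)) (\<phi> n v)"
proof -
  have n: "1 \<le> n" "1 \<le> Suc n" using R(3) N_ge_2 by auto
  have iR: "finite (insert i R)" "card (insert i R) = Suc n" "insert i R - {i} = R" using R i by auto
  note en = bij_numbering[OF R(1,2)]
  define p where "p = quo n (numbering R) f"
  have p: "p permutes {1..n}" unfolding p_def by (rule quo_permutes[OF en f])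
  have bij: "bij_betw ((numbering R)(Suc n := i)) {1..Suc n} (insert i R)"
    by (rule bij_betw_upd_Suc[OF en i])
  have "ee i (insert i R) (coord R f v) = coord (insert i R) ((numbering R)(Suc n := i)) (\<phi> n (\<rho> n p v))"
    using R(3) unfolding ee_def iR coord_def[of R] R(2) p_def by simp
  also have "\<dots> = coord (insert i R) ((numbering R)(Suc n := i)) (\<rho> (Suc n) p (\<phi> n v))"
    by (simp add: phi_rho[OF n(1) p v])
  also have "\<dots> = coord (insert i R) ((numbering R)(Suc n := i) \<circ> p) (\<phi> n v)"
    by (rule coord_rho[OF iR(1,2) n(2) bij permutes_Suc[OF p] phi_mem[OF n(1) v]])
  also have "\<dots> = coord (insert i R) (f(Suc n := i)) (\<phi> n v)"
  proof (rule coord_cong[OF iR(1,2) n(2)])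
    fix x assume "x \<in> {1..Suc n}"
    then consider "x \<in> {1..n}" | "x = Suc n" by fastforce
    then show "((numbering R)(Suc n := i) \<circ> p) x = (f(Suc n := i)) x"
    proof cases
      case 1
      then have "p x \<in> {1..n}" using permutes_in_image[OF p] by blast
      then show ?thesis using apply_quo[OF en f 1] 1 by (auto simp: p_def)
    next
      case 2
      then have "p x = x" using p by (intro permutes_not_in) auto
      then show ?thesis using 2 by simp
    qed
  qed
  finally show ?thesis .
qed

lemma ee_numbering:
  assumes "finite R" "card R = n" "N \<le> Suc n" "i \<notin> R" "v \<in> V n"
  shows "ee i (insert i R) v = coord (insert i R) ((numbering R)(Suc n := i)) (\<phi> n v)"
  using ee_coord[OF assms(1-4) bij_numbering[OF assms(1,2)] assms(5)] coord_numbering[OF assms(1,2)] assms N_ge_2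
  by simp

lemma bij_replace:
  assumes "i \<notin> S" "j \<notin> S" "bij_betw f A (insert i S)"
  shows "bij_betw ((id(i := j)) \<circ> f) A (insert j S)"
proof -
  have "bij_betw (id(i := j)) (insert i S) (insert j S)"
    using assms(1,2) by (auto simp: bij_betw_def inj_on_def)
  then show ?thesis by (rule bij_betw_trans[OF assms(3)])
qed

lemma swap_coord:
  assumes S: "finite S" "card S + 1 = n" "N \<le> Suc n" and ij: "i \<notin> S" "j \<notin> S"
    and f: "bij_betw f {1..n} (insert i S)" and v: "v \<in> V n"
  shows "swap i j S (coord (insert i S) f v) = coord (insert j S) ((id(i := j)) \<circ> f) v"
proof -
  have n: "1 \<le> n" using S by simp
  have iS: "finite (insert i S)" "card (insert i S) = n" and jS: "finite (insert j S)" "card (insert j S) = n"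
    using S ij by auto
  note en = bij_numbering[OF iS]
  define p where "p = quo n (numbering (insert i S)) f"
  have p: "p permutes {1..n}" unfolding p_def by (rule quo_permutes[OF en f])
  have "swap i j S (coord (insert i S) f v) =
      coord (insert j S) ((id(i := j)) \<circ> numbering (insert i S)) (\<rho> n p v)"
    using S unfolding swap_def coord_def[of "insert i S"] iS(2) p_def by simp
  also have "\<dots> = coord (insert j S) ((id(i := j)) \<circ> numbering (insert i S) \<circ> p) v"
    by (rule coord_rho[OF jS n bij_replace[OF ij en] p v])
  also have "\<dots> = coord (insert j S) ((id(i := j)) \<circ> f) v"
    by (rule coord_cong[OF jS n]) (simp add: p_def apply_quo[OF en f])
  finally show ?thesis .
qed

lemma swap_numbering:
  assumes "finite S" "card S + 1 = n" "N \<le> Suc n" "i \<notin> S" "j \<notin> S" "v \<in> V n"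
  shows "swap i j S v = coord (insert j S) ((id(i := j)) \<circ> numbering (insert i S)) v"
proof -
  have iS: "finite (insert i S)" "card (insert i S) = n" using assms by auto
  show ?thesis
    using swap_coord[OF assms(1-5) bij_numbering[OF iS] assms(6)] coord_numbering[OF iS] assms by simp
qed

end

subsection \<open>Central stabilization\<close>

lemma vector_space_fun_scale:
  assumes "vector_space s"
  shows "vector_space (fun_scale s)"
proof -
  interpret vector_space s by fact
  show ?thesis
    by unfold_locales
      (simp_all add: fun_scale_def fun_eq_iff plus_fun_def scale_right_distrib scale_left_distrib)
qed

lemma sum_fun_eq: "(\<Sum>i\<in>A. f i) = (\<lambda>x. \<Sum>i\<in>A. f i x)"
  by (induction A rule: infinite_finite_induct) (simp_all add: fun_eq_iff plus_fun_def zero_fun_def)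

lemma permutes_Suc_fixed:
  assumes p: "p permutes {1..Suc n}" and fixed: "p (Suc n) = Suc n"
  shows "p permutes {1..n}"
proof (rule permutes_superset[OF p])
  fix x assume "x \<in> {1..Suc n} - {1..n}"
  then have "x = Suc n" by auto
  then show "p x = x" using fixed by simp
qed

lemma permutes_comp_iff:
  assumes "p permutes A"
  shows "q \<circ> p permutes A \<longleftrightarrow> q permutes A" and "p \<circ> q permutes A \<longleftrightarrow> q permutes A"
proof -
  have "q = q \<circ> p \<circ> inv p" "q = inv p \<circ> (p \<circ> q)"
    using permutes_inv_o[OF assms] by (simp_all add: comp_assoc) (simp add: comp_assoc[symmetric])
  then show "q \<circ> p permutes A \<longleftrightarrow> q permutes A" "p \<circ> q permutes A \<longleftrightarrow> q permutes A"
    using permutes_compose permutes_inv[OF assms] assms by metis+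
qed

context central_sequence
begin

context
  fixes n :: nat assumes n: "1 \<le> n"
begin

lemma ind_incl_mem:
  assumes v: "v \<in> V n"
  shows "ind_incl n (\<rho> n) v \<in> ind_space n (V n) (\<rho> n)"
  unfolding ind_space_def mem_Collect_eq
proof (intro conjI allI impI)
  fix p assume "p permutes {1..Suc n}"
  show "ind_incl n (\<rho> n) v p \<in> V n"
    using rho_mem[OF n permutes_inv v] subspace_0[OF subspace_rep[OF n]] by (simp add: ind_incl_def)
next
  fix p assume "\<not> p permutes {1..Suc n}"
  then have "\<not> p permutes {1..n}" using permutes_Suc by blast
  then show "ind_incl n (\<rho> n) v p = 0" by (simp add: ind_incl_def)
next
  fix p q assume q: "q permutes {1..n}"
  show "ind_incl n (\<rho> n) v (p \<circ> q) = \<rho> n (inv q) (ind_incl n (\<rho> n) v p)"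
  proof (cases "p permutes {1..n}")
    case True
    then have "inv (p \<circ> q) = inv q \<circ> inv p" using q by (intro o_inv_distrib permutes_bij)
    then show ?thesis
      using rho_comp[OF n permutes_inv[OF q] permutes_inv[OF True] v] True permutes_comp_iff(1)[OF q]
      by (simp add: ind_incl_def)
  next
    case False
    then show ?thesis
      using permutes_comp_iff(1)[OF q] rho_0[OF n permutes_inv[OF q]] by (simp add: ind_incl_def)
  qed
qed

lemma ind_act_mem:
  assumes p: "p permutes {1..Suc n}" and w: "w \<in> ind_space n (V n) (\<rho> n)"
  shows "ind_act p w \<in> ind_space n (V n) (\<rho> n)"
  using w permutes_comp_iff(2)[OF permutes_inv[OF p]]
  by (simp add: ind_space_def ind_act_def comp_assoc[symmetric])

lemma ind_space_add:
  assumes "w \<in> ind_space n (V n) (\<rho> n)" "w' \<in> ind_space n (V n) (\<rho> n)"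
  shows "w + w' \<in> ind_space n (V n) (\<rho> n)"
  using assms subspace_add[OF subspace_rep[OF n]] linear_on_add[OF linear_rho[OF n permutes_inv] subspace_rep[OF n]]
  by (simp add: ind_space_def plus_fun_def)

lemma ind_space_0: "0 \<in> ind_space n (V n) (\<rho> n)"
  using subspace_0[OF subspace_rep[OF n]] rho_0[OF n permutes_inv]
  by (simp add: ind_space_def zero_fun_def)

lemma ind_space_sum:
  "(\<And>i. i \<in> A \<Longrightarrow> w i \<in> ind_space n (V n) (\<rho> n)) \<Longrightarrow> (\<Sum>i\<in>A. w i) \<in> ind_space n (V n) (\<rho> n)"
  by (induction A rule: infinite_finite_induct) (auto intro: ind_space_0 ind_space_add)

end

abbreviation "rel n \<equiv> stab_rel scale n (\<rho> n) (V (n - 1)) (\<phi> (n - 1))"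

lemma
  shows rel_coset_eq: "w - w' \<in> rel n \<Longrightarrow> w +o rel n = w' +o rel n"
    and rel_coset_eqD: "w +o rel n = w' +o rel n \<Longrightarrow> w - w' \<in> rel n"
proof -
  interpret F: vector_space "fun_scale scale :: 'a \<Rightarrow> ((nat \<Rightarrow> nat) \<Rightarrow> 'v) \<Rightarrow> _"
    by (rule vector_space_fun_scale) unfold_locales
  have sub: "F.subspace (rel n)" unfolding stab_rel_def by (rule F.subspace_span)
  have 0: "0 \<in> rel n" by (rule F.subspace_0[OF sub])
  show "w +o rel n = w' +o rel n" if d: "w - w' \<in> rel n"
  proof -
    have "w + b = w' + ((w - w') + b)" "w' + b = w + (b - (w - w'))" for b by simp_all
    then show ?thesis
      using F.subspace_add[OF sub d] F.subspace_diff[OF sub _ d] unfolding elt_set_plus_def by blast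
  qed
  show "w - w' \<in> rel n" if eq: "w +o rel n = w' +o rel n"
  proof -
    have "w + 0 \<in> w +o rel n" by (rule set_plus_intro2[OF 0])
    then have "w \<in> w' +o rel n" unfolding eq by simp
    then show ?thesis unfolding set_minus_plus[symmetric] .
  qed
qed

text \<open>The isomorphism composed with the quotient map: a map on the induced representation
  whose kernel lies in \<open>rel n\<close>. Cosets do not appear beyond this point.\<close>

lemma stab_quotient:
  assumes n: "N \<le> n"
  obtains T where
    "\<And>v. v \<in> V (Suc n) \<Longrightarrow> \<exists>w\<in>ind_space n (V n) (\<rho> n). T w = v"
    "\<And>w. w \<in> ind_space n (V n) (\<rho> n) \<Longrightarrow> T w = 0 \<Longrightarrow> w \<in> rel n"
    "\<And>w w'. w - w' \<in> rel n \<Longrightarrow> T w = T w'"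
    "T 0 = 0"
    "\<And>w w'. w \<in> ind_space n (V n) (\<rho> n) \<Longrightarrow> w' \<in> ind_space n (V n) (\<rho> n) \<Longrightarrow> T (w + w') = T w + T w'"
    "\<And>p w. p permutes {1..Suc n} \<Longrightarrow> w \<in> ind_space n (V n) (\<rho> n) \<Longrightarrow> T (ind_act p w) = \<rho> (Suc n) p (T w)"
    "\<And>v. v \<in> V n \<Longrightarrow> T (ind_incl n (\<rho> n) v) = \<phi> n v"
proof -
  obtain T where T: "central_stab_iso scale n (V n) (\<rho> n) (V (n - 1)) (\<phi> (n - 1)) (V (Suc n)) (\<rho> (Suc n)) T"
    and Tphi: "\<forall>v\<in>V n. T (central_stab_map scale n (\<rho> n) (V (n - 1)) (\<phi> (n - 1)) v) = \<phi> n v"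
    using stable n unfolding centrally_stable_from_def by blast
  have n1: "1 \<le> n" using n N_ge_2 by simp
  let ?W = "ind_space n (V n) (\<rho> n)"
  have bij: "bij_betw T ((\<lambda>w. w +o rel n) ` ?W) (V (Suc n))"
    and add: "\<And>w w'. w \<in> ?W \<Longrightarrow> w' \<in> ?W \<Longrightarrow> T ((w + w') +o rel n) = T (w +o rel n) + T (w' +o rel n)"
    and act: "\<And>p w. p permutes {1..Suc n} \<Longrightarrow> w \<in> ?W \<Longrightarrow> T (ind_act p w +o rel n) = \<rho> (Suc n) p (T (w +o rel n))"
    using T unfolding central_stab_iso_def central_stab_def Let_def by blast+
  have zero: "T (0 +o rel n) = 0"
    using add[OF ind_space_0[OF n1] ind_space_0[OF n1]] by simp
  show ?thesis
  proof (rule that[of "\<lambda>w. T (w +o rel n)"])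
    fix v assume "v \<in> V (Suc n)"
    then have "v \<in> T ` (\<lambda>w. w +o rel n) ` ?W" using bij by (simp add: bij_betw_def)
    then show "\<exists>w\<in>?W. T (w +o rel n) = v" by auto
  next
    fix w assume w: "w \<in> ?W" "T (w +o rel n) = 0"
    then have "w +o rel n = 0 +o rel n"
      using bij zero ind_space_0[OF n1] unfolding bij_betw_def inj_on_def by (metis imageI)
    then show "w \<in> rel n" using rel_coset_eqD[of w n 0] by simp
  qed (use rel_coset_eq add act zero Tphi in \<open>simp_all add: central_stab_map_def\<close>)
qed

lemma generator_mem_rel:
  assumes "p permutes {1..Suc n}" "v \<in> V (n - 1)"
  shows "ind_act p (ind_incl n (\<rho> n) (\<phi> (n - 1) v) -
    ind_act (transpose n (Suc n)) (ind_incl n (\<rho> n) (\<phi> (n - 1) v))) \<in> rel n"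
proof -
  interpret F: vector_space "fun_scale scale :: 'a \<Rightarrow> ((nat \<Rightarrow> nat) \<Rightarrow> 'v) \<Rightarrow> _"
    by (rule vector_space_fun_scale) unfold_locales
  show ?thesis
    unfolding stab_rel_def
    by (rule F.span_base, rule CollectI, intro exI conjI refl imageI) (use assms in auto)
qed

text \<open>The generator \<open>w - ind_act t w\<close> of the relations at level
  \<open>Suc m\<close> maps to zero, read off in \<open>V\<close>. It says that two added points may
  be exchanged. The bound on \<open>m\<close> is the one at which \<open>VV\<close> is
  truncated.\<close>

lemma transpose_phi_phi:
  assumes m: "N \<le> Suc m" and v: "v \<in> V m"
  shows "\<rho> (Suc (Suc m)) (transpose (Suc m) (Suc (Suc m))) (\<phi> (Suc m) (\<phi> m v)) = \<phi> (Suc m) (\<phi> m v)"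
proof -
  define t where "t = transpose (Suc m) (Suc (Suc m))"
  have t: "t permutes {1..Suc (Suc m)}" unfolding t_def by (rule permutes_swap_id) auto
  have m1: "1 \<le> m" "1 \<le> Suc m" using m N_ge_2 by auto
  obtain T where T: "\<And>w w'. w - w' \<in> rel (Suc m) \<Longrightarrow> T w = T w'"
    "\<And>p w. p permutes {1..Suc (Suc m)} \<Longrightarrow> w \<in> ind_space (Suc m) (V (Suc m)) (\<rho> (Suc m)) \<Longrightarrow>
      T (ind_act p w) = \<rho> (Suc (Suc m)) p (T w)"
    "\<And>v. v \<in> V (Suc m) \<Longrightarrow> T (ind_incl (Suc m) (\<rho> (Suc m)) v) = \<phi> (Suc m) v"
    by (rule stab_quotient[OF m], rule that) assumption+
  define w where "w = ind_incl (Suc m) (\<rho> (Suc m)) (\<phi> m v)"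
  have pv: "\<phi> m v \<in> V (Suc m)" using phi_mem[OF m1(1) v] .
  have w: "w \<in> ind_space (Suc m) (V (Suc m)) (\<rho> (Suc m))"
    unfolding w_def by (rule ind_incl_mem[OF m1(2) pv])
  have "ind_act id u = u" for u :: "(nat \<Rightarrow> nat) \<Rightarrow> 'v" by (simp add: ind_act_def)
  then have "w - ind_act t w \<in> rel (Suc m)"
    using generator_mem_rel[of id "Suc m" v] v permutes_id by (simp add: w_def t_def)
  then have "T w = T (ind_act t w)" by (rule T(1))
  then show ?thesis using T(2)[OF t w] T(3)[OF pv] by (simp add: w_def t_def)
qed

section \<open>Verification of the functor axioms\<close>

lemma subspace_VV: "subspace (VV S)"
  using subspace_rep N_ge_2 by (simp add: VV_def subspace_single_0)

lemma ee_linear: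
  assumes S: "finite S" and i: "i \<in> S"
  shows "linear_on scale scale (VV (S - {i})) (VV S) (ee i S)"
proof (cases "N \<le> card S")
  case True
  then obtain n where n: "card S = Suc n" "1 \<le> n" using N_ge_2 by (cases "card S") auto
  have Si: "finite (S - {i})" "card (S - {i}) = n" "insert i (S - {i}) = S"
    using S i n by auto
  have "bij_betw ((numbering (S - {i}))(Suc n := i)) {1..Suc n} S"
    using bij_betw_upd_Suc[OF bij_numbering[OF Si(1,2)], of i] Si(3) by simp
  then have c: "linear_on scale scale (V (Suc n)) (V (Suc n)) (coord S ((numbering (S - {i}))(Suc n := i)))"
    by (intro linear_coord[OF S n(1)]) simp_all
  have "linear_on scale scale (V n) (V (Suc n)) (\<lambda>v. coord S ((numbering (S - {i}))(Suc n := i)) (\<phi> n v))"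
    using linear_phi[OF n(2)] c unfolding linear_on_def by simp
  then show ?thesis
    using True n Si(2) by (simp add: VV_def ee_def[abs_def])
next
  case False
  moreover have "card (S - {i}) + 1 = card S" using S i by (metis Suc_eq_plus1 card_Suc_Diff1)
  ultimately have "VV (S - {i}) = {0}" by (simp add: VV_def)
  then show ?thesis
    using False subspace_0[OF subspace_VV] by (simp add: ee_def[abs_def] linear_on_def)
qed

lemma ee_0: "finite S \<Longrightarrow> i \<in> S \<Longrightarrow> ee i S 0 = 0"
  using linear_on_0[OF ee_linear subspace_VV] .

lemma swap_linear:
  assumes S: "finite S" and ij: "i \<notin> S" "j \<notin> S"
  shows "linear_on scale scale (VV (insert i S)) (VV (insert j S)) (swap i j S)"
proof (cases "N \<le> card S + 2")
  case True
  define n where "n = card S + 1"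
  have iS: "finite (insert i S)" "card (insert i S) = n" and jS: "finite (insert j S)" "card (insert j S) = n"
    using S ij by (auto simp: n_def)
  have "linear_on scale scale (V n) (V n) (coord (insert j S) ((id(i := j)) \<circ> numbering (insert i S)))"
    using ij by (intro linear_coord[OF jS] bij_replace bij_numbering[OF iS]) (auto simp: n_def)
  then show ?thesis
    using True iS(2) jS(2) by (simp add: VV_def swap_def[abs_def] n_def)
next
  case False
  then show ?thesis using S ij by (auto simp: VV_def swap_def linear_on_def)
qed

lemma swap_0: "finite S \<Longrightarrow> i \<notin> S \<Longrightarrow> j \<notin> S \<Longrightarrow> swap i j S 0 = 0"
  using linear_on_0[OF swap_linear subspace_VV] .

text \<open>Both sides of each identity become \<open>coord\<close> of explicit enumerations that
  agree on the relevant positions. Only the commuting of two additions needs central stability,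
  through \<open>transpose_phi_phi\<close>. Below the truncation the vectors are zero.\<close>

lemma subset_module_VV: "subset_module scale UNIV VV ee swap"
proof unfold_locales
  fix S :: "nat set"
  show "subspace (VV S)" by (rule subspace_VV)
next
  fix S :: "nat set" and i assume "finite S" "i \<in> S"
  then show "linear_on scale scale (VV (S - {i})) (VV S) (ee i S)" by (rule ee_linear)
next
  fix S :: "nat set" and i j v
  assume S: "finite S" and ij: "i \<in> S" "j \<in> S" "i \<noteq> j" and v: "v \<in> VV (S - {i} - {j})"
  define R where "R = S - {i} - {j}"
  define n where "n = card R"
  have R: "finite R" "card R = n" "i \<notin> R" "j \<notin> R" "S - {i} = insert j R" "S - {j} = insert i R"
    "S = insert i (insert j R)" "S = insert j (insert i R)"
    using S ij by (auto simp: R_def n_def)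
  show "ee i S (ee j (S - {i}) v) = ee j S (ee i (S - {j}) v)"
  proof (cases "N \<le> Suc n")
    case True
    then have v: "v \<in> V n" using v by (simp add: VV_def R_def[symmetric] n_def)
    have n1: "1 \<le> n" "1 \<le> Suc n" using True N_ge_2 by auto
    have *: "ee i (insert i (insert j R)) (ee j (insert j R) v) =
      coord (insert i (insert j R)) ((numbering R)(Suc n := j, Suc (Suc n) := i)) (\<phi> (Suc n) (\<phi> n v))"
      if "i \<notin> R" "j \<notin> R" "i \<noteq> j" for i j
      using that R(1,2) True v phi_mem[OF n1(1) v] bij_betw_upd_Suc[OF bij_numbering[OF R(1,2)] that(2)]
      by (simp add: ee_numbering ee_coord)
    \<comment> \<open>The two orders of adding \<open>i\<close> and \<open>j\<close> give
      enumerations that differ by exchanging the last two positions. The vector is fixed by this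
      exchange.\<close>
    define t where "t = transpose (Suc n) (Suc (Suc n))"
    have t: "t permutes {1..Suc (Suc n)}" unfolding t_def by (rule permutes_swap_id) auto
    have c: "card S = Suc (Suc n)" using R ij(3) by simp
    have n2: "1 \<le> Suc (Suc n)" by simp
    define f where "f = (numbering R)(Suc n := j, Suc (Suc n) := i)"
    have "bij_betw ((numbering R)(Suc n := j)) {1..Suc n} (insert j R)"
      by (rule bij_betw_upd_Suc[OF bij_numbering[OF R(1,2)] R(4)])
    then have f: "bij_betw f {1..Suc (Suc n)} S"
      unfolding f_def R(7) using bij_betw_upd_Suc[of "(numbering R)(Suc n := j)" "Suc n" "insert j R" i] R(3) ij(3)
      by simp
    have "coord S f (\<phi> (Suc n) (\<phi> n v)) = coord S f (\<rho> (Suc (Suc n)) t (\<phi> (Suc n) (\<phi> n v)))"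
      unfolding t_def by (simp add: transpose_phi_phi[OF True v])
    also have "\<dots> = coord S (f \<circ> t) (\<phi> (Suc n) (\<phi> n v))"
      using phi_mem[OF n1(2) phi_mem[OF n1(1) v]] by (rule coord_rho[OF S c n2 f t])
    also have "f \<circ> t = (numbering R)(Suc n := i, Suc (Suc n) := j)"
      by (auto simp: fun_eq_iff f_def t_def transpose_def)
    finally show ?thesis
      unfolding f_def *[OF R(3,4) ij(3), folded R(7), folded R(5)]
        *[OF R(4,3) ij(3)[symmetric], folded R(8), folded R(6)] .
  next
    case False
    then have "v = 0" using v by (simp add: VV_def R_def[symmetric] n_def)
    then show ?thesis using S ij by (simp add: ee_0)
  qed
next
  fix S :: "nat set" and i j assume "finite S" "i \<in> UNIV - S" "j \<in> UNIV - S"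
  then show "linear_on scale scale (VV (insert i S)) (VV (insert j S)) (swap i j S)"
    by (intro swap_linear) auto
next
  fix S :: "nat set" and i j v
  assume S: "finite S" and ij: "i \<in> UNIV - S" "j \<in> UNIV - S" and v: "v \<in> VV S"
  show "swap i j S (ee i (insert i S) v) = ee j (insert j S) v"
  proof (cases "N \<le> card S + 1")
    case True
    define n where "n = card S"
    have v': "v \<in> V n" using v True by (simp add: VV_def n_def)
    have n1: "1 \<le> n" using True N_ge_2 by (simp add: n_def)
    have jS: "finite (insert j S)" "card (insert j S) = Suc n"
      using S ij by (auto simp: n_def)
    have bij: "bij_betw ((numbering S)(Suc n := i)) {1..Suc n} (insert i S)"
      using ij by (intro bij_betw_upd_Suc bij_numbering[OF S]) (auto simp: n_def)
    have "swap i j S (ee i (insert i S) v) =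
        coord (insert j S) ((id(i := j)) \<circ> (numbering S)(Suc n := i)) (\<phi> n v)"
      using S ij v' True phi_mem[OF n1 v'] bij
      by (simp add: ee_numbering[of S n] swap_coord[of S "Suc n"] n_def)
    also have "\<dots> = coord (insert j S) ((numbering S)(Suc n := j)) (\<phi> n v)"
    proof (rule coord_cong[OF jS])
      fix x assume "x \<in> {1..Suc n}"
      then consider "x \<in> {1..n}" "x \<noteq> Suc n" | "x = Suc n" by fastforce
      then show "((id(i := j)) \<circ> (numbering S)(Suc n := i)) x = ((numbering S)(Suc n := j)) x"
        using bij_betwE[OF bij_numbering[OF S n_def[symmetric]]] ij by cases auto
    qed simp
    also have "\<dots> = ee j (insert j S) v"
      using S ij v' True by (simp add: ee_numbering[of S n] n_def)
    finally show ?thesis .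
  next
    case False
    then have "v = 0" using v by (simp add: VV_def)
    then show ?thesis using S ij by (simp add: ee_0 swap_0)
  qed
next
  fix S :: "nat set" and i j k v
  assume S: "finite S" and ij: "i \<in> UNIV - S" "j \<in> UNIV - S" and k: "k \<in> S"
    and v: "v \<in> VV (insert i (S - {k}))"
  let ?R = "S - {k}"
  define n where "n = card ?R + 1"
  have R: "finite ?R" "insert k (insert i ?R) = insert i S" "insert k (insert j ?R) = insert j S"
    "i \<notin> ?R" "j \<notin> ?R" "k \<notin> insert i ?R" "k \<notin> insert j ?R" "card S = n" "i \<noteq> k"
    using S ij k card_Suc_Diff1[OF S k] by (auto simp: n_def)
  have iR: "finite (insert i ?R)" "card (insert i ?R) = n" and jR: "finite (insert j ?R)" "card (insert j ?R) = n"
    using R by (auto simp: n_def)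
  have jS: "finite (insert j S)" "card (insert j S) = Suc n" using S ij R by auto
  show "swap i j S (ee k (insert i S) v) = ee k (insert j S) (swap i j ?R v)"
  proof (cases "N \<le> Suc n")
    case True
    have v': "v \<in> V n" using v True iR(2) by (simp add: VV_def)
    have n1: "1 \<le> n" by (simp add: n_def)
    let ?f = "numbering (insert i ?R)" and ?h = "id(i := j)"
    have bij: "bij_betw (?f(Suc n := k)) {1..Suc n} (insert i S)"
      using bij_betw_upd_Suc[OF bij_numbering[OF iR] R(6)] R(2) by simp
    have "swap i j S (ee k (insert i S) v) = coord (insert j S) (?h \<circ> (?f(Suc n := k))) (\<phi> n v)"
      using ee_numbering[OF iR True R(6) v'] R(2) swap_coord[OF S _ _ _ _ bij phi_mem[OF n1 v']] ij R(8) True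
      by simp
    also have "?h \<circ> (?f(Suc n := k)) = (?h \<circ> ?f)(Suc n := k)"
      using R(9) by (auto simp: fun_eq_iff)
    also have "coord (insert j S) ((?h \<circ> ?f)(Suc n := k)) (\<phi> n v) =
        ee k (insert j S) (coord (insert j ?R) (?h \<circ> ?f) v)"
      using ee_coord[OF jR True R(7) bij_replace[OF R(4,5) bij_numbering[OF iR]] v'] R(3) by simp
    also have "coord (insert j ?R) (?h \<circ> ?f) v = swap i j ?R v"
      using swap_numbering[OF R(1) n_def[symmetric] True R(4,5) v'] by simp
    finally show ?thesis .
  next
    case False
    then have "swap i j ?R v = 0" "v = 0"
      using v iR(2) by (auto simp: swap_def n_def VV_def)
    then show ?thesis using S k ij by (simp add: ee_0 swap_0)
  qed
next
  fix S :: "nat set" and i j v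
  assume S: "finite S" and ij: "i \<in> UNIV - S" "j \<in> UNIV - S" and v: "v \<in> VV (insert i S)"
  define n where "n = card S + 1"
  have iS: "finite (insert i S)" "card (insert i S) = n" using S ij by (auto simp: n_def)
  show "swap j i S (swap i j S v) = v"
  proof (cases "N \<le> Suc n")
    case True
    have v': "v \<in> V n" using v True iS(2) by (simp add: VV_def)
    have n1: "1 \<le> n" by (simp add: n_def)
    let ?f = "numbering (insert i S)"
    have ij': "i \<notin> S" "j \<notin> S" using ij by auto
    have "swap j i S (swap i j S v) = coord (insert i S) ((id(j := i)) \<circ> ((id(i := j)) \<circ> ?f)) v"
      using swap_numbering[OF S n_def[symmetric] True ij' v']
        swap_coord[OF S n_def[symmetric] True ij'(2,1) bij_replace[OF ij' bij_numbering[OF iS]] v'] by simp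
    also have "\<dots> = coord (insert i S) ?f v"
      using bij_betwE[OF bij_numbering[OF iS]] ij' by (intro coord_cong[OF iS n1]) auto
    also have "\<dots> = v" by (rule coord_numbering[OF iS n1 v'])
    finally show ?thesis .
  next
    case False
    then show ?thesis using v iS(2) by (simp add: swap_def n_def VV_def)
  qed
qed

end

section \<open>Exactness in degrees 0 and 1 from central stability\<close>

context subset_module
begin

lemma e_scale:
  assumes "finite S" "S \<subseteq> U" "i \<in> S" "v \<in> V (S - {i})"
  shows "e i S (c *s v) = c *s e i S v"
  using linear_on_scale[OF linear_e[OF assms(1-3)] subspace_V_Diff[OF assms(1,2)] assms(4)] .

lemma bd_add_scale:
  assumes S: "finite S" "S \<subseteq> U" and x: "chain1 V S x" and y: "chain1 V S y"
  shows "bd e S (\<lambda>i. x i + c *s y i) = bd e S x + c *s bd e S y"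
proof -
  have "e i S (x i + c *s y i) = e i S (x i) + c *s e i S (y i)" if i: "i \<in> S" for i
  proof -
    have "x i \<in> V (S - {i})" "y i \<in> V (S - {i})" using x y i by (simp_all add: chain1_def)
    then show ?thesis
      using S i by (simp add: e_add e_scale subspace_scale[OF subspace_V_Diff])
  qed
  then show ?thesis by (simp add: bd_def sum.distrib scale_sum_right)
qed

lemma chain2_add_scale:
  assumes S: "finite S" "S \<subseteq> U" and z: "chain2 V S z" and y: "chain2 V S y"
  shows "chain2 V S (\<lambda>i j. z i j + c *s y i j)"
  unfolding chain2_def
proof (intro ballI conjI)
  fix i j assume ij: "i \<in> S" "j \<in> S - {i}"
  have "subspace (V (S - {i} - {j}))" using S by (intro subspace_V) auto
  then show "z i j + c *s y i j \<in> V (S - {i} - {j})"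
    using subspace_add subspace_scale chain2D(1)[OF z ij] chain2D(1)[OF y ij] by blast
  show "z j i + c *s y j i = - (z i j + c *s y i j)"
    using chain2D(2)[OF z ij] chain2D(2)[OF y ij] by simp
qed

end

context central_sequence
begin

text \<open>The induced representation is the space of 1-chains at \<open>S\<close>: an element
  \<open>w\<close> is determined by its values \<open>w (\<sigma> i)\<close> at coset
  representatives indexed by the points of \<open>S\<close>. Under this identification the quotient
  map \<open>T\<close> becomes \<open>bd\<close>, and the generators of \<open>rel n\<close> become
  boundaries of 2-chains supported on one pair of points. Surjectivity of \<open>T\<close> thus
  gives exactness in degree 0, and its kernel lying in \<open>rel n\<close> gives exactness in
  degree 1.\<close>

lemma exact_VV:
  assumes S: "finite S" "card S = Suc n" and n: "N \<le> n"
  shows "exact0 VV ee S \<and> exact1 VV ee S"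
proof -
  interpret M: subset_module scale UNIV VV ee swap by (rule subset_module_VV)
  interpret F: vector_space "fun_scale scale :: 'a \<Rightarrow> ((nat \<Rightarrow> nat) \<Rightarrow> 'v) \<Rightarrow> _"
    by (rule vector_space_fun_scale) unfold_locales
  have n1: "1 \<le> n" "1 \<le> n - 1" "Suc (n - 1) = n" using n N_ge_2 by auto
  have Si: "finite (S - {i})" "card (S - {i}) = n" "i \<notin> S - {i}" "insert i (S - {i}) = S" if "i \<in> S" for i
    using S that by auto
  note en = bij_numbering[OF S]
  \<comment> \<open>\<open>g i\<close> lists \<open>S - {i}\<close> by its own numbering and puts
    \<open>i\<close> last; \<open>\<sigma> i\<close> is this enumeration relative to
    \<open>numbering S\<close>. With these representatives, \<open>ee i S\<close> is literally
    \<open>\<phi> n\<close> followed by \<open>\<rho> (Suc n) (\<sigma> i)\<close>.\<close>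
  define g where "g = (\<lambda>i. (numbering (S - {i}))(Suc n := i))"
  define \<sigma> where "\<sigma> = (\<lambda>i. quo (Suc n) (numbering S) (g i))"
  have g: "bij_betw (g i) {1..Suc n} S" if "i \<in> S" for i
    unfolding g_def using bij_betw_upd_Suc[OF bij_numbering[OF Si(1,2)] Si(3)] Si(4) that by metis
  have \<sigma>: "\<sigma> i permutes {1..Suc n}" if "i \<in> S" for i
    unfolding \<sigma>_def by (rule quo_permutes[OF en g[OF that]])
  have num_\<sigma>: "numbering S (\<sigma> i x) = g i x" if "i \<in> S" "x \<in> {1..Suc n}" for i x
    unfolding \<sigma>_def by (rule apply_quo[OF en g[OF that(1)] that(2)])
  have ee_\<sigma>: "ee i S v = \<rho> (Suc n) (\<sigma> i) (\<phi> n v)" if "i \<in> S" for i v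
    using n unfolding ee_def coord_def S(2) \<sigma>_def g_def by simp
  have VS: "VV S = V (Suc n)" and VSi: "VV (S - {i}) = V n" if "i \<in> S" for i
    using S n Si(2)[OF that] by (simp_all add: VV_def)
  have VSij: "VV (S - {i} - {j}) = V (n - 1)" "card (S - {i} - {j}) = n - 1"
    if "i \<in> S" "j \<in> S" "i \<noteq> j" for i j
  proof -
    show "card (S - {i} - {j}) = n - 1" using Si(1,2)[OF that(1)] that by simp
    then show "VV (S - {i} - {j}) = V (n - 1)" using n n1(3) by (simp add: VV_def)
  qed
  \<comment> \<open>The coset of \<open>p\<close> is determined by where \<open>p\<close> sends the
    last letter, and that letter corresponds to a point of \<open>S\<close>.\<close>
  have coset: "(inv (\<sigma> i) \<circ> p) permutes {1..n} \<longleftrightarrow> i = numbering S (p (Suc n))"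
    if p: "p permutes {1..Suc n}" and i: "i \<in> S" for p i
  proof
    let ?q = "inv (\<sigma> i) \<circ> p"
    have \<sigma>q: "\<sigma> i (?q x) = p x" for x
      using permutes_inverses(1)[OF \<sigma>[OF i]] by simp
    have top: "numbering S (\<sigma> i (Suc n)) = i" using num_\<sigma>[OF i, of "Suc n"] by (simp add: g_def)
    {
      assume "?q permutes {1..n}"
      then have "?q (Suc n) = Suc n" by (rule permutes_not_in) simp
      then show "i = numbering S (p (Suc n))" using \<sigma>q[of "Suc n"] top by simp
    next
      assume "i = numbering S (p (Suc n))"
      then have "numbering S (\<sigma> i (Suc n)) = numbering S (p (Suc n))" using top by simp
      then have "\<sigma> i (Suc n) = p (Suc n)"
        using permutes_in_image[OF \<sigma>[OF i], of "Suc n"] permutes_in_image[OF p, of "Suc n"]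
        by (auto simp: inj_on_eq_iff[OF bij_betw_imp_inj_on[OF en]])
      then have "?q (Suc n) = Suc n"
        unfolding comp_apply using permutes_inverses(2)[OF \<sigma>[OF i], of "Suc n"] by simp
      then show "?q permutes {1..n}"
        by (rule permutes_Suc_fixed[OF permutes_compose[OF p permutes_inv[OF \<sigma>[OF i]]]])
    }
  qed
  \<comment> \<open>The left side is the entry at \<open>i\<close> of the 1-chain of the translate
    by \<open>p\<close> of the included vector \<open>u\<close>. This chain has a single entry, at
    the point in last position.\<close>
  have incl: "ind_incl n (\<rho> n) u (inv p \<circ> \<sigma> i) =
      (if i = numbering S (p (Suc n)) then coord (S - {i}) (numbering S \<circ> p) u else 0)"
    if p: "p permutes {1..Suc n}" and i: "i \<in> S" for p u i
  proof -
    define q where "q = inv (\<sigma> i) \<circ> p"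
    have q: "q permutes {1..Suc n}" unfolding q_def
      by (intro permutes_compose p permutes_inv[OF \<sigma>[OF i]])
    have inv_q: "inv p \<circ> \<sigma> i = inv q"
      unfolding q_def using permutes_bij[OF p] permutes_bij[OF permutes_inv[OF \<sigma>[OF i]]]
      by (simp add: o_inv_distrib permutes_inv_inv[OF \<sigma>[OF i]])
    have iff: "inv q permutes {1..n} \<longleftrightarrow> q permutes {1..n}"
      using permutes_inv permutes_inv_inv[OF q] by metis
    show ?thesis
    proof (cases "i = numbering S (p (Suc n))")
      case True
      then have qn: "q permutes {1..n}" using coset[OF p i] by (simp add: q_def)
      have bp: "bij_betw (numbering S \<circ> p) {1..n} (S - {i})"
        using bij_betw_restrict_Suc(1)[OF bij_betw_comp_permutes[OF en p]] True by simp
      have "q = quo n (numbering (S - {i})) (numbering S \<circ> p)"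
      proof (rule quo_unique[OF bij_numbering[OF Si(1,2)[OF i]] bp qn])
        fix x assume x: "x \<in> {1..n}"
        then have qx: "q x \<in> {1..n}" using permutes_in_image[OF qn] by blast
        have "numbering (S - {i}) (q x) = g i (q x)" using qx by (simp add: g_def)
        also have "\<dots> = numbering S (\<sigma> i (q x))" using num_\<sigma>[OF i, of "q x"] qx by simp
        also have "\<sigma> i (q x) = p x" using permutes_inverses(1)[OF \<sigma>[OF i]] by (simp add: q_def)
        finally show "numbering (S - {i}) (q x) = (numbering S \<circ> p) x" by simp
      qed
      then show ?thesis
        using True qn iff permutes_inv_inv[OF q] Si(2)[OF i] inv_q by (simp add: ind_incl_def coord_def)
    next
      case False
      then have "\<not> inv q permutes {1..n}" using coset[OF p i] iff by (simp add: q_def)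
      then show ?thesis using False inv_q by (simp add: ind_incl_def)
    qed
  qed
  define W where "W = ind_space n (V n) (\<rho> n)"
  \<comment> \<open>The inverse of taking the values at all \<open>\<sigma> i\<close>; in tensor
    notation, the sum of \<open>\<sigma> i\<close> tensor \<open>x i\<close>. At any
    \<open>p\<close> only the summand of its own coset survives.\<close>
  define \<Phi> where "\<Phi> = (\<lambda>x. \<Sum>i\<in>S. ind_act (\<sigma> i) (ind_incl n (\<rho> n) (x i)))"
  have act_W: "ind_act (\<sigma> i) (ind_incl n (\<rho> n) v) \<in> W" if "i \<in> S" "v \<in> V n" for i v
    unfolding W_def by (intro ind_act_mem[OF n1(1) \<sigma>[OF that(1)]] ind_incl_mem[OF n1(1) that(2)])
  have \<Phi>_W: "\<Phi> x \<in> W" if "\<And>i. i \<in> S \<Longrightarrow> x i \<in> V n" for x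
    unfolding \<Phi>_def W_def using act_W that by (intro ind_space_sum[OF n1(1)]) (simp add: W_def)
  have \<Phi>_eq: "\<Phi> (\<lambda>i. w (\<sigma> i)) = w" if w: "w \<in> W" for w
  proof
    fix p
    have eq: "\<Phi> (\<lambda>i. w (\<sigma> i)) p = (\<Sum>i\<in>S. ind_incl n (\<rho> n) (w (\<sigma> i)) (inv (\<sigma> i) \<circ> p))"
      by (simp add: \<Phi>_def sum_fun_eq ind_act_def)
    show "\<Phi> (\<lambda>i. w (\<sigma> i)) p = w p"
    proof (cases "p permutes {1..Suc n}")
      case True
      define k where "k = numbering S (p (Suc n))"
      have k: "k \<in> S"
        using bij_betwE[OF en] permutes_in_image[OF True, of "Suc n"] by (simp add: k_def)
      have "ind_incl n (\<rho> n) (w (\<sigma> i)) (inv (\<sigma> i) \<circ> p) = (if i = k then w p else 0)" if i: "i \<in> S" for i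
      proof (cases "i = k")
        case ik: True
        then have q: "(inv (\<sigma> i) \<circ> p) permutes {1..n}" using coset[OF True i] by (simp add: k_def)
        have "\<sigma> i \<circ> (inv (\<sigma> i) \<circ> p) = p"
          using permutes_inv_o(1)[OF \<sigma>[OF i]] by (simp add: comp_assoc[symmetric])
        then have "w p = \<rho> n (inv (inv (\<sigma> i) \<circ> p)) (w (\<sigma> i))"
          using w q \<sigma>[OF i] unfolding W_def ind_space_def mem_Collect_eq by metis
        then show ?thesis using q ik by (simp add: ind_incl_def)
      next
        case False
        then show ?thesis using coset[OF True i] by (simp add: ind_incl_def k_def)
      qed
      then show ?thesis unfolding eq using S(1) k by simp
    next
      case False
      have "\<not> (inv (\<sigma> i) \<circ> p) permutes {1..n}" if i: "i \<in> S" for i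
        using False permutes_Suc permutes_comp_iff(2)[OF permutes_inv[OF \<sigma>[OF i]]] by blast
      then have "\<Phi> (\<lambda>i. w (\<sigma> i)) p = 0" unfolding eq by (simp add: ind_incl_def)
      then show ?thesis using w False by (simp add: W_def ind_space_def)
    qed
  qed
  have \<Phi>_\<sigma>: "\<Phi> x (\<sigma> j) = x j" if "j \<in> S" "\<And>i. i \<in> S \<Longrightarrow> x i \<in> V n" for x j
  proof -
    have "ind_incl n (\<rho> n) (x i) (inv (\<sigma> i) \<circ> \<sigma> j) = (if i = j then x j else 0)" if i: "i \<in> S" for i
    proof (cases "i = j")
      case True
      then show ?thesis
        using permutes_inv_o(2)[OF \<sigma>[OF i]] rho_id[OF n1(1) \<open>\<And>i. i \<in> S \<Longrightarrow> x i \<in> V n\<close>[OF i]]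
        by (simp add: ind_incl_def permutes_id inv_id[unfolded id_def[symmetric]])
    next
      case False
      have "numbering S (\<sigma> j (Suc n)) = j" using num_\<sigma>[OF \<open>j \<in> S\<close>, of "Suc n"] by (simp add: g_def)
      then show ?thesis using False coset[OF \<sigma>[OF \<open>j \<in> S\<close>] i] by (simp add: ind_incl_def)
    qed
    then show ?thesis using S(1) \<open>j \<in> S\<close> by (simp add: \<Phi>_def sum_fun_eq ind_act_def)
  qed
  obtain T where T: "\<And>v. v \<in> V (Suc n) \<Longrightarrow> \<exists>w\<in>W. T w = v"
    "\<And>w. w \<in> W \<Longrightarrow> T w = 0 \<Longrightarrow> w \<in> rel n"
    "T 0 = 0"
    "\<And>w w'. w \<in> W \<Longrightarrow> w' \<in> W \<Longrightarrow> T (w + w') = T w + T w'"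
    "\<And>p w. p permutes {1..Suc n} \<Longrightarrow> w \<in> W \<Longrightarrow> T (ind_act p w) = \<rho> (Suc n) p (T w)"
    "\<And>v. v \<in> V n \<Longrightarrow> T (ind_incl n (\<rho> n) v) = \<phi> n v"
    by (rule stab_quotient[OF n, folded W_def], rule that) assumption+
  have T_\<Phi>: "T (\<Phi> x) = bd ee S x" if x: "\<And>i. i \<in> S \<Longrightarrow> x i \<in> V n" for x
  proof -
    have "T (\<Sum>i\<in>A. ind_act (\<sigma> i) (ind_incl n (\<rho> n) (x i))) =
        (\<Sum>i\<in>A. T (ind_act (\<sigma> i) (ind_incl n (\<rho> n) (x i))))" if "finite A" "A \<subseteq> S" for A
      using that
    proof (induction A)
      case (insert i A)
      have iA: "i \<in> S" "A \<subseteq> S" using insert.prems by auto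
      have "(\<Sum>i\<in>A. ind_act (\<sigma> i) (ind_incl n (\<rho> n) (x i))) \<in> W"
        unfolding W_def using act_W x insert.prems by (intro ind_space_sum[OF n1(1)]) (auto simp: W_def)
      then show ?case
        unfolding sum.insert[OF insert.hyps] insert.IH[OF iA(2), symmetric]
        by (rule T(4)[OF act_W[OF iA(1) x[OF iA(1)]]])
    qed (simp add: T(3))
    then have "T (\<Phi> x) = (\<Sum>i\<in>S. T (ind_act (\<sigma> i) (ind_incl n (\<rho> n) (x i))))"
      using S(1) by (simp add: \<Phi>_def)
    also have "\<dots> = bd ee S x"
      unfolding bd_def using T(5)[OF \<sigma>] T(6) ind_incl_mem[OF n1(1)] x
      by (intro sum.cong) (auto simp: ee_\<sigma> W_def)
    finally show ?thesis .
  qed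
  have "exact0 VV ee S"
    unfolding exact0_def
  proof
    fix v assume v: "v \<in> VV S"
    have "S \<noteq> {}" using S by auto
    then have "v \<in> V (Suc n)" using v VS by blast
    then obtain w where w: "w \<in> W" "T w = v" using T(1) by blast
    have x: "w (\<sigma> i) \<in> V n" if "i \<in> S" for i
      using w(1) \<sigma>[OF that] by (simp add: W_def ind_space_def)
    then have "chain1 VV S (\<lambda>i. w (\<sigma> i))" by (simp add: chain1_def VSi)
    moreover have "v = bd ee S (\<lambda>i. w (\<sigma> i))" using T_\<Phi>[of "\<lambda>i. w (\<sigma> i)", OF x] \<Phi>_eq[OF w(1)] w(2) by simp
    ultimately show "\<exists>x. chain1 VV S x \<and> v = bd ee S x" by blast
  qed
  \<comment> \<open>The elements whose 1-chain is a boundary. They form a subspace, so it is enough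
    to find the generators of \<open>rel n\<close> in it.\<close>
  define G where "G = {w. \<exists>z. chain2 VV S z \<and> (\<forall>i\<in>S. w (\<sigma> i) = bd ee (S - {i}) (z i))}"
  have G_add_scale: "w + fun_scale scale c w' \<in> G" if "w \<in> G" "w' \<in> G" for w w' c
  proof -
    obtain z where z: "chain2 VV S z" "\<And>i. i \<in> S \<Longrightarrow> w (\<sigma> i) = bd ee (S - {i}) (z i)"
      using \<open>w \<in> G\<close> by (auto simp: G_def)
    obtain y where y: "chain2 VV S y" "\<And>i. i \<in> S \<Longrightarrow> w' (\<sigma> i) = bd ee (S - {i}) (y i)"
      using \<open>w' \<in> G\<close> by (auto simp: G_def)
    have "(w + fun_scale scale c w') (\<sigma> i) = bd ee (S - {i}) (\<lambda>j. z i j + c *s y i j)" if i: "i \<in> S" for i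
      using M.bd_add_scale[OF Si(1)[OF i] _ M.chain2_chain1[OF z(1) i] M.chain2_chain1[OF y(1) i]] z(2) y(2) i
      by (simp add: fun_scale_def plus_fun_def)
    then show ?thesis
      using M.chain2_add_scale[OF S(1) _ z(1) y(1), of c] unfolding G_def by blast
  qed
  have G_0: "0 \<in> G"
  proof -
    have "bd ee (S - {i}) (\<lambda>_. 0) = 0" if "i \<in> S" for i
      using Si(1)[OF that] by (auto simp: bd_def ee_0 intro!: sum.neutral)
    moreover have "chain2 VV S (\<lambda>_ _. 0)"
      by (simp add: chain2_def subspace_0[OF subspace_VV])
    ultimately show ?thesis unfolding G_def by (auto intro!: exI[of _ "\<lambda>_ _. 0"])
  qed
  have G: "F.subspace G"
  proof (rule F.subspaceI[OF G_0])
    show "x + y \<in> G" if "x \<in> G" "y \<in> G" for x y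
      using G_add_scale[OF that, of 1] by (simp add: F.scale_one)
    show "fun_scale scale c x \<in> G" if "x \<in> G" for c x
      using G_add_scale[OF G_0 that, of c] by simp
  qed
  \<comment> \<open>The translates by \<open>p\<close> and by \<open>p \<circ> t\<close> sit at the
    two points \<open>a\<close> and \<open>b\<close> that \<open>p\<close> puts in the last two
    positions. Both entries come from one vector \<open>c\<close> attached to
    \<open>S - {a} - {b}\<close>, by adding \<open>b\<close> and \<open>a\<close>
    respectively.\<close>
  have gen: "ind_act p (ind_incl n (\<rho> n) (\<phi> (n - 1) v) -
      ind_act (transpose n (Suc n)) (ind_incl n (\<rho> n) (\<phi> (n - 1) v))) \<in> G"
    if p: "p permutes {1..Suc n}" and v: "v \<in> V (n - 1)" for p v
  proof -
    define t where "t = transpose n (Suc n)"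
    have t: "t permutes {1..Suc n}" unfolding t_def using n1 by (intro permutes_swap_id) auto
    have t_eq: "t n = Suc n" "t (Suc n) = n" "inv t = t" by (simp_all add: t_def)
    have pt: "p \<circ> t permutes {1..Suc n}" by (rule permutes_compose[OF t p])
    define f where "f = numbering S \<circ> p"
    define u where "u = \<phi> (n - 1) v"
    have f: "bij_betw f {1..Suc n} S" unfolding f_def by (rule bij_betw_comp_permutes[OF en p])
    have ft: "bij_betw (f \<circ> t) {1..Suc n} S" by (rule bij_betw_comp_permutes[OF f t])
    define a where "a = f (Suc n)"
    define b where "b = f n"
    have ab: "a \<in> S" "b \<in> S" "a \<noteq> b"
      using bij_betwE[OF f] bij_betw_imp_inj_on[OF f] n1 unfolding a_def b_def by (auto dest: inj_onD)
    define c where "c = coord (S - {a} - {b}) f v"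
    \<comment> \<open>Since \<open>u\<close> is in the image of \<open>\<phi> (n - 1)\<close>, its
      class arises from a smaller set by adding the point in position \<open>n\<close>.\<close>
    have face: "coord (S - {k (Suc n)}) k u =
        ee (k n) (S - {k (Suc n)}) (coord (S - {k (Suc n)} - {k n}) k v) \<and>
        bij_betw k {1..n - 1} (S - {k (Suc n)} - {k n})"
      if k: "bij_betw k {1..Suc n} S" for k
    proof -
      let ?R = "S - {k (Suc n)} - {k n}"
      note k1 = bij_betw_restrict_Suc[OF k]
      have "bij_betw k {1..Suc (n - 1)} (S - {k (Suc n)})" using k1(1) n1(3) by simp
      note k2 = bij_betw_restrict_Suc[OF this]
      have k3: "bij_betw k {1..n - 1} ?R" "k n \<in> S - {k (Suc n)}" using k2 n1(3) by simp_all
      then have R: "finite ?R" "card ?R = n - 1" "N \<le> Suc (n - 1)" "k n \<notin> ?R" "insert (k n) ?R = S - {k (Suc n)}"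
        using S(1) n n1(3) VSij(2)[OF k1(2), of "k n"] by auto
      have "k(Suc (n - 1) := k n) = k" using n1(3) by simp
      then show ?thesis
        using ee_coord[OF R(1-4) k3(1) v] R(5) k3(1) by (simp add: u_def)
    qed
    \<comment> \<open>\<open>t\<close> moves only the positions \<open>n\<close> and
      \<open>Suc n\<close>, while the class of \<open>v\<close> sees the first
      \<open>n - 1\<close>.\<close>
    have swap_c: "coord (S - {b} - {a}) (f \<circ> t) v = c"
    proof -
      have eq: "S - {b} - {a} = S - {a} - {b}" by blast
      show ?thesis
        unfolding c_def eq
      proof (rule coord_cong)
        show "finite (S - {a} - {b})" "card (S - {a} - {b}) = n - 1" "1 \<le> n - 1"
          using S(1) VSij(2) ab n1 by auto
        fix x assume "x \<in> {1..n - 1}"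
        then show "(f \<circ> t) x = f x" using n1(3) by (simp add: t_def transpose_def)
      qed
    qed
    have fa: "coord (S - {a}) f u = ee b (S - {a}) c"
      using face[OF f] by (simp add: a_def b_def c_def)
    have fb: "coord (S - {b}) (f \<circ> t) u = ee a (S - {b}) c"
      using face[OF ft] swap_c by (simp add: a_def b_def t_eq)
    have c: "c \<in> VV (S - {a} - {b})" "c \<in> VV (S - {b} - {a})"
    proof -
      have "c \<in> V (n - 1)"
        unfolding c_def using face[OF f] S(1) VSij(2)[OF ab] n1(2) v
        by (intro coord_mem) (auto simp: a_def b_def)
      then show "c \<in> VV (S - {a} - {b})" "c \<in> VV (S - {b} - {a})"
        using VSij(1) ab by auto
    qed
    \<comment> \<open>The minus sign demanded by antisymmetry is the minus sign in the
      generator.\<close>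
    define z where "z = (\<lambda>i j. if i = a \<and> j = b then c else if i = b \<and> j = a then - c else 0)"
    have "chain2 VV S z"
      unfolding chain2_def z_def
      using c ab subspace_neg[OF subspace_VV] subspace_0[OF subspace_VV] by auto
    moreover have "ind_act p (ind_incl n (\<rho> n) u - ind_act t (ind_incl n (\<rho> n) u)) (\<sigma> i) =
        bd ee (S - {i}) (z i)" if i: "i \<in> S" for i
    proof -
      have "inv t \<circ> (inv p \<circ> \<sigma> i) = inv (p \<circ> t) \<circ> \<sigma> i"
        using permutes_bij[OF p] permutes_bij[OF t] by (simp add: o_inv_distrib comp_assoc)
      then have "ind_act p (ind_incl n (\<rho> n) u - ind_act t (ind_incl n (\<rho> n) u)) (\<sigma> i) =
          (if i = a then coord (S - {a}) f u else 0) - (if i = b then coord (S - {b}) (f \<circ> t) u else 0)"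
        using incl[OF p i, of u] incl[OF pt i, of u]
        by (simp add: ind_act_def t_eq a_def b_def f_def comp_assoc)
      also have "\<dots> = bd ee (S - {i}) (z i)"
      proof -
        have sum1: "bd ee (S - {i}) y = ee k (S - {i}) (y k)"
          if "k \<in> S - {i}" "\<And>j. j \<noteq> k \<Longrightarrow> y j = 0" for k y
        proof -
          have "bd ee (S - {i}) y = (\<Sum>j\<in>S - {i}. if j = k then ee k (S - {i}) (y k) else 0)"
            unfolding bd_def using that Si(1)[OF i] by (intro sum.cong) (auto simp: ee_0)
          then show ?thesis using that(1) S(1) by simp
        qed
        consider "i = a" | "i = b" | "i \<noteq> a" "i \<noteq> b" by blast
        then show ?thesis
        proof cases
          case 1
          then show ?thesis using sum1[of b "z i"] ab fa by (simp add: z_def)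
        next
          case 2
          have "ee a (S - {b}) (- c) = - ee a (S - {b}) c"
            using M.e_minus[OF Si(1)[OF ab(2)] _ _ c(2)] ab by simp
          then show ?thesis using 2 sum1[of a "z i"] ab fb by (simp add: z_def)
        next
          case 3
          then show ?thesis using Si(1)[OF i] by (auto simp: bd_def z_def ee_0 intro!: sum.neutral[symmetric])
        qed
      qed
      finally show ?thesis .
    qed
    ultimately show ?thesis unfolding G_def t_def u_def by blast
  qed
  have rel_G: "rel n \<subseteq> G"
    unfolding stab_rel_def by (rule F.span_minimal[OF _ G]) (use gen in auto)
  have "exact1 VV ee S"
    unfolding exact1_def
  proof (intro allI impI)
    fix x assume x: "chain1 VV S x" "bd ee S x = 0"
    have xV: "x i \<in> V n" if "i \<in> S" for i using x(1) that VSi by (simp add: chain1_def)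
    have "\<Phi> x \<in> rel n" using T(2)[OF \<Phi>_W] T_\<Phi> x(2) xV by simp
    then obtain z where "chain2 VV S z" "\<And>i. i \<in> S \<Longrightarrow> \<Phi> x (\<sigma> i) = bd ee (S - {i}) (z i)"
      using rel_G by (auto simp: G_def)
    then show "\<exists>z. chain2 VV S z \<and> (\<forall>i\<in>S. x i = bd ee (S - {i}) (z i))"
      using \<Phi>_\<sigma> xV by auto
  qed
  with \<open>exact0 VV ee S\<close> show ?thesis by blast
qed

end

theorem theorem4:
  fixes s :: "'a::field \<Rightarrow> 'v::ab_group_add \<Rightarrow> 'v"
    and V :: "nat \<Rightarrow> 'v set"
    and \<rho> :: "nat \<Rightarrow> (nat \<Rightarrow> nat) \<Rightarrow> 'v \<Rightarrow> 'v"
    and \<phi> :: "nat \<Rightarrow> 'v \<Rightarrow> 'v"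
    and N :: nat
  assumes "vector_space s"
    and "coherent_sequence s V \<rho> \<phi>"
    and "centrally_stable_from s V \<rho> \<phi> N"
    and "CHAR('a) = 0 \<or> CHAR('a) \<ge> 2 * N + 2"
  shows "(\<forall>n\<ge>2 * N + 1. \<not> fin_dim s (V n)) \<or>
         (\<exists>p :: rat poly. \<forall>n\<ge>2 * N + 1.
            fin_dim s (V n) \<and> poly p (of_nat n) = of_nat (vector_space.dim s (V n)))"
proof -
  interpret central_sequence s V \<rho> \<phi> N
    using assms(1-3) by (simp add: central_sequence_def central_sequence_axioms_def)
  \<comment> \<open>Exactness holds from \<open>N + 1\<close> points on, so the dichotomy is applied
    with \<open>N + 1\<close>, and its range \<open>2 * (N + 1) \<le> card S + 1\<close> means
    \<open>2 * N + 1 \<le> card S\<close>.\<close>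
  have ex: "exact0 VV ee S \<and> exact1 VV ee S" if S: "finite S" "N + 1 \<le> card S" for S
    using exact_VV[OF S(1), of "card S - 1"] S(2) by simp
  have VV: "VV {1..n} = V n" if "n \<ge> 2 * N + 1" for n
    using that by (simp add: VV_def)
  have "(\<forall>S. finite S \<longrightarrow> S \<subseteq> UNIV \<longrightarrow> 2 * (N + 1) \<le> card S + 1 \<longrightarrow> \<not> fin_dim s (VV S)) \<or>
    (\<exists>K (c :: nat \<Rightarrow> rat). \<forall>S. finite S \<longrightarrow> S \<subseteq> UNIV \<longrightarrow> 2 * (N + 1) \<le> card S + 1 \<longrightarrow>
      fin_dim s (VV S) \<and> of_nat (dim (VV S)) = (\<Sum>k<K. c k * of_nat (card S choose k)))"
    using dim_dichotomy[OF subset_module_VV infinite_UNIV_nat ex] by blast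
  then consider "\<And>S. finite S \<Longrightarrow> 2 * (N + 1) \<le> card S + 1 \<Longrightarrow> \<not> fin_dim s (VV S)"
    | K and c :: "nat \<Rightarrow> rat" where "\<And>S. finite S \<Longrightarrow> 2 * (N + 1) \<le> card S + 1 \<Longrightarrow>
      fin_dim s (VV S) \<and> of_nat (dim (VV S)) = (\<Sum>k<K. c k * of_nat (card S choose k))"
    by blast
  then show ?thesis
  proof cases
    case 1
    have "\<not> fin_dim s (V n)" if "n \<ge> 2 * N + 1" for n
      using 1[of "{1..n}"] VV[OF that] that by simp
    then show ?thesis by blast
  next
    case 2
    obtain p :: "rat poly" where p: "\<And>n. poly p (of_nat n) = (\<Sum>k<K. c k * of_nat (n choose k))"
      using ex_poly_binomial_sum by metis
    have "fin_dim s (V n) \<and> poly p (of_nat n) = of_nat (dim (V n))" if "n \<ge> 2 * N + 1" for n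
      using 2[of "{1..n}"] VV[OF that] that p by simp
    then show ?thesis by blast
  qed
qed

end
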